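(* Consider a hybrid system with parameter $\theta$, as described in the context, and a hybrid arc $x(t,\theta)$ of it with event times $\tau_j$. The matrix containing the sensitivities of the state variables with respect to the parameters, $Z(t):=\partial x(t,\theta)/\partial\theta$, evolves as follows. (1) For a mode $q\in Q$, while the dynamics are flowing, $$\dot Z(t)=D_xf_q(x(t),\theta)\,Z(t)+D_\theta f_q(x(t),\theta),\qquad t\in(\tau_j,\tau_{j+1}).$$ (2) At event time $\tau_j$, where the mode switches from $q$ to $q'$ and the state undergoes the reset $$x(\tau_j^+)=R_{qq'}(x(\tau_j^-),\theta)+\eta_j(\theta),$$ with $\eta_j(\theta)$ denoting the reset noise, which may depend on the parameter, the sensitivity is updated by $$Z(\tau_j^+)=\Xi_j\,Z(\tau_j^-)+D_\theta R_{qq'}(x(\tau_j^-),\theta)+D_\theta\eta_j(\theta),$$ where $\Xi_j$ is the saltation matrix associated with the $j$-th transition, defined in the context. (3) If $\eta_j$ is i.i.d. and independent of $\theta$ ($D_\theta\eta_j=0$), the update reduces to $$Z(\tau_j^+)=\Xi_j\,Z(\tau_j^-)+D_\theta R_{qq'}(x(\tau_j^-),\theta).$$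
   Context: Notation: superscripts $-$ and $+$ denote quantities immediately before and after an event; $D_x,D_\theta,D_t$ denote partial derivatives with respect to state, parameter and time. Hybrid system: a finite set $Q$ of modes and a continuous state space $X\subseteq\mathbb{R}^n$; in mode $q$ the state flows by $\dot x=f_q(x,\theta)$ while it lies in the invariant set of $q$; a transition from mode $q$ to mode $q'$ is triggered by a guard condition $g_{qq'}=0$ with scalar guard function $g_{qq'}$, and the state is then reset using the reset map $R_{qq'}$. A hybrid arc is a trajectory of this system, consisting of flows separated by transitions at the event times $\tau_j$. Standing assumption: the hybrid system is piecewise smooth, with differentiable vector fields and reset maps, transversal guard crossings, and finitely many transitions on compact time intervals. Saltation matrix of the $j$-th transition, from $q$ to $q'$ at time $\tau_j$: $$\Xi_j=D_xR_{qq'}^-+\frac{\big(f_{q'}^+-D_xR_{qq'}^-f_q^--D_tR_{qq'}^-\big)D_xg_{qq'}^-}{D_tg_{qq'}^-+D_xg_{qq'}^-f_q^-},\qquad\text{where } D_tg_{qq'}^-+D_xg_{qq'}^-f_q^-\neq0 ;$$ here $f_q^-$ and the derivatives of $R_{qq'}$ and $g_{qq'}$ are evaluated immediately before the event and $f_{q'}^+$ immediately after it. *)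

theory Defs
  imports "HOL-Analysis.Analysis" "HOL-Probability.Probability"
begin

(* Guards depend on time and state only, resets also on the parameter, vector fields are
   autonomous: guard H q q' t x, reset H q q' t x p, vfield H q x p. *)
record ('q, 'n, 'p) hybrid_system =
  modes :: "'q set"
  states :: "(real ^ 'n::finite) set"
  params :: "(real ^ 'p::finite) set"
  invariant :: "'q \<Rightarrow> (real ^ 'n) set"
  vfield :: "'q \<Rightarrow> real ^ 'n \<Rightarrow> real ^ 'p \<Rightarrow> real ^ 'n"
  guard :: "'q \<Rightarrow> 'q \<Rightarrow> real \<Rightarrow> real ^ 'n \<Rightarrow> real"
  reset :: "'q \<Rightarrow> 'q \<Rightarrow> real \<Rightarrow> real ^ 'n \<Rightarrow> real ^ 'p \<Rightarrow> real ^ 'n"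

definition C1_on :: "('a::real_normed_vector \<Rightarrow> 'b::real_normed_vector) \<Rightarrow> 'a set \<Rightarrow> bool" where
  "C1_on F S \<longleftrightarrow>
     (\<exists>F'. (\<forall>z\<in>S. (F has_derivative blinfun_apply (F' z)) (at z)) \<and> continuous_on S F')"

(* The state space need not be open; the vector fields are C1 on a neighbourhood of it, and
   the derivatives of guards and resets at its points are the full ones. *)
definition smooth_hybrid_system :: "('q, 'n::finite, 'p::finite) hybrid_system \<Rightarrow> bool" where
  "smooth_hybrid_system H \<longleftrightarrow>
     finite (modes H) \<and> open (params H) \<and>
     (\<forall>q\<in>modes H. \<exists>U. open U \<and> states H \<subseteq> U \<and>
        C1_on (\<lambda>(x, \<theta>). vfield H q x \<theta>) (U \<times> params H)) \<and>
     (\<forall>q\<in>modes H. \<forall>q'\<in>modes H. \<forall>t. \<forall>x\<in>states H.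
        (\<lambda>(s, y). guard H q q' s y) differentiable (at (t, x)) \<and>
        (\<forall>\<theta>\<in>params H. (\<lambda>(s, y, \<phi>). reset H q q' s y \<phi>) differentiable (at (t, x, \<theta>))))"

definition left_lim :: "(real \<Rightarrow> 'a::t2_space) \<Rightarrow> real \<Rightarrow> 'a" where
  "left_lim y s = Lim (at_left s) y"

definition right_lim :: "(real \<Rightarrow> 'a::t2_space) \<Rightarrow> real \<Rightarrow> 'a" where
  "right_lim y s = Lim (at_right s) y"

(* An arc on [t0, T) with N transitions: q 0, ..., q N are the successive modes, the j-th
   transition (1 \<le> j \<le> N) is from q (j - 1) to q j at time \<tau> j with reset noise \<xi> j, and
   \<tau> 0 = t0, \<tau> (N + 1) = T. The value of y at an event time itself is irrelevant. *)
definition hybrid_arc ::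
  "('q, 'n::finite, 'p::finite) hybrid_system \<Rightarrow> (nat \<Rightarrow> real ^ 'n) \<Rightarrow> real ^ 'p \<Rightarrow>
   real \<Rightarrow> real \<Rightarrow> nat \<Rightarrow> (nat \<Rightarrow> 'q) \<Rightarrow> (nat \<Rightarrow> real) \<Rightarrow> (real \<Rightarrow> real ^ 'n) \<Rightarrow> bool" where
  "hybrid_arc H \<xi> \<theta> t0 T N q \<tau> y \<longleftrightarrow>
     (\<forall>j\<le>N. q j \<in> modes H) \<and>
     \<tau> 0 = t0 \<and> \<tau> (Suc N) = T \<and> (\<forall>j\<le>N. \<tau> j < \<tau> (Suc j)) \<and>
     y t0 \<in> states H \<and> (y \<longlongrightarrow> y t0) (at_right t0) \<and>
     (\<forall>j\<le>N. \<forall>t\<in>{\<tau> j<..<\<tau> (Suc j)}.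
        y t \<in> states H \<inter> invariant H (q j) \<and>
        (y has_vector_derivative vfield H (q j) (y t) \<theta>) (at t)) \<and>
     (\<forall>j\<in>{1..N}. \<exists>xm\<in>states H. \<exists>xp\<in>states H.
        (y \<longlongrightarrow> xm) (at_left (\<tau> j)) \<and> (y \<longlongrightarrow> xp) (at_right (\<tau> j)) \<and>
        guard H (q (j - 1)) (q j) (\<tau> j) xm = 0 \<and>
        xp = reset H (q (j - 1)) (q j) (\<tau> j) xm \<theta> + \<xi> j)"

definition Dx_vfield ::
  "('q, 'n::finite, 'p::finite) hybrid_system \<Rightarrow> 'q \<Rightarrow> real ^ 'n \<Rightarrow> real ^ 'p \<Rightarrow> real ^ 'n ^ 'n" where
  "Dx_vfield H q x \<theta> = jacobian (\<lambda>y. vfield H q y \<theta>) (at x)"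

definition Dp_vfield ::
  "('q, 'n::finite, 'p::finite) hybrid_system \<Rightarrow> 'q \<Rightarrow> real ^ 'n \<Rightarrow> real ^ 'p \<Rightarrow> real ^ 'p ^ 'n" where
  "Dp_vfield H q x \<theta> = jacobian (\<lambda>\<phi>. vfield H q x \<phi>) (at \<theta>)"

definition Dt_guard ::
  "('q, 'n::finite, 'p::finite) hybrid_system \<Rightarrow> 'q \<Rightarrow> 'q \<Rightarrow> real \<Rightarrow> real ^ 'n \<Rightarrow> real" where
  "Dt_guard H q q' t x = deriv (\<lambda>s. guard H q q' s x) t"

(* as a row, i.e. a 1 x n matrix *)
definition Dx_guard ::
  "('q, 'n::finite, 'p::finite) hybrid_system \<Rightarrow> 'q \<Rightarrow> 'q \<Rightarrow> real \<Rightarrow> real ^ 'n \<Rightarrow> real ^ 'n ^ 1" where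
  "Dx_guard H q q' t x = jacobian (\<lambda>y. vec (guard H q q' t y)) (at x)"

definition Dt_reset ::
  "('q, 'n::finite, 'p::finite) hybrid_system \<Rightarrow> 'q \<Rightarrow> 'q \<Rightarrow> real \<Rightarrow> real ^ 'n \<Rightarrow> real ^ 'p \<Rightarrow>
   real ^ 'n" where
  "Dt_reset H q q' t x \<theta> = vector_derivative (\<lambda>s. reset H q q' s x \<theta>) (at t)"

definition Dx_reset ::
  "('q, 'n::finite, 'p::finite) hybrid_system \<Rightarrow> 'q \<Rightarrow> 'q \<Rightarrow> real \<Rightarrow> real ^ 'n \<Rightarrow> real ^ 'p \<Rightarrow>
   real ^ 'n ^ 'n" where
  "Dx_reset H q q' t x \<theta> = jacobian (\<lambda>y. reset H q q' t y \<theta>) (at x)"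

definition Dp_reset ::
  "('q, 'n::finite, 'p::finite) hybrid_system \<Rightarrow> 'q \<Rightarrow> 'q \<Rightarrow> real \<Rightarrow> real ^ 'n \<Rightarrow> real ^ 'p \<Rightarrow>
   real ^ 'p ^ 'n" where
  "Dp_reset H q q' t x \<theta> = jacobian (\<lambda>\<phi>. reset H q q' t x \<phi>) (at \<theta>)"

definition crossing_rate ::
  "('q, 'n::finite, 'p::finite) hybrid_system \<Rightarrow> 'q \<Rightarrow> 'q \<Rightarrow> real \<Rightarrow> real ^ 'n \<Rightarrow> real ^ 'p \<Rightarrow> real" where
  "crossing_rate H q q' t xm \<theta> = Dt_guard H q q' t xm + (Dx_guard H q q' t xm *v vfield H q xm \<theta>) $ 1"

(* xm and xp are the states immediately before and after the event, the latter including
   the reset noise. *)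
definition saltation_matrix ::
  "('q, 'n::finite, 'p::finite) hybrid_system \<Rightarrow> 'q \<Rightarrow> 'q \<Rightarrow> real \<Rightarrow> real ^ 'n \<Rightarrow> real ^ 'n \<Rightarrow>
   real ^ 'p \<Rightarrow> real ^ 'n ^ 'n" where
  "saltation_matrix H q q' t xm xp \<theta> =
     Dx_reset H q q' t xm \<theta> +
     (1 / crossing_rate H q q' t xm \<theta>) *\<^sub>R
       ((columnvector (vfield H q' xp \<theta> - Dx_reset H q q' t xm \<theta> *v vfield H q xm \<theta>
                       - Dt_reset H q q' t xm \<theta>) :: real ^ 1 ^ 'n)
        ** Dx_guard H q q' t xm)"

definition sensitivity ::
  "(real \<Rightarrow> real ^ 'p::finite \<Rightarrow> real ^ 'n::finite) \<Rightarrow> real ^ 'p \<Rightarrow> real \<Rightarrow> real ^ 'p ^ 'n" where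
  "sensitivity x \<theta> t = jacobian (\<lambda>\<phi>. x t \<phi>) (at \<theta>)"

definition iid_sequence :: "'w measure \<Rightarrow> (nat \<Rightarrow> 'w \<Rightarrow> 'a::topological_space) \<Rightarrow> bool" where
  "iid_sequence M \<xi> \<longleftrightarrow>
     prob_space.indep_vars M (\<lambda>_. borel) \<xi> {1..} \<and>
     (\<forall>j\<ge>1. distr M borel (\<xi> j) = distr M borel (\<xi> 1))"

end

theory Submission
  imports Defs
begin

text \<open>
  Compare the reference arc with a perturbed one segment by segment, after rescaling both segments
  affinely to a common time interval. To first order in the parameter increment \<open>h\<close> and
  in the increments of the two end times, the perturbed solution evaluated at its own final time
  \<open>b\<close> differs from the reference by \<open>Z(b0) h + (b - b0) f\<close>, where
  \<open>Z\<close> solves the variational equation and \<open>f\<close> is the velocity at the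
  reference end point. At an event the vanishing of the guard then determines the derivative of the
  event time by transversality, as in the implicit function theorem, from differentiability of the
  guard at the reference point alone. The reset map gives the derivative of the
  restarted state, and subtracting the velocity times the derivative of the event time gives the new
  initial value of \<open>Z\<close>: this produces the saltation matrix.
\<close>

section \<open>Differential equations\<close>

text \<open>The difficulty is a circularity. Event times are only assumed continuous in the
  parameter, yet the state at an event depends on the event time and the event time on the state.
  The expansion along a segment is therefore proved before anything is known about the derivative of
  its end time, with an error relative to the sum of the parameter increment and the end time
  increment. Transversality afterwards bounds the second increment by a multiple of the first.
  Differentiability at a fixed time between events uses the same expansion with a constant end time.
  A second constraint is that arcs have one-sided limits at events but none is assumed at the final
  time \<open>T\<close>, so the last segment is always cut off before its end.\<close>

text \<open>
  The derivative bound is needed only inside the tube of radius \<open>r\<close>: the conclusion itself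
  shows that \<open>e\<close> never leaves it.
\<close>

lemma gronwall_tube:
  fixes e :: "real \<Rightarrow> 'a::real_normed_vector"
  assumes b: "0 \<le> b" and cont: "continuous_on {0..b} e"
    and deriv: "\<And>u. 0 < u \<Longrightarrow> u < b \<Longrightarrow> (e has_vector_derivative e' u) (at u)"
    and bound: "\<And>u. 0 < u \<Longrightarrow> u < b \<Longrightarrow> norm (e u) < r \<Longrightarrow> norm (e' u) \<le> K * norm (e u) + d"
    and init: "norm (e 0) \<le> c" and K: "0 \<le> K" and d: "0 \<le> d"
    and r: "(c + d * b) * exp (K * b) < r"
    and u: "0 \<le> u" "u \<le> b"
  shows "norm (e u) \<le> (c + d * u) * exp (K * u)"
proof -
  \<comment> \<open>The slack \<open>c < c'\<close> makes the bound strict at \<open>0\<close>, so a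
    first time of violation would be positive. It is removed at the end by letting \<open>c'\<close>
    decrease to \<open>c\<close>.\<close>
  have strict: "norm (e u) < (c' + d * u) * exp (K * u)"
    if c': "c < c'" and r': "(c' + d * b) * exp (K * b) < r" and u: "0 \<le> u" "u \<le> b" for c' u
  proof (rule ccontr)
    assume neg: "\<not> ?thesis"
    define g where "g = (\<lambda>u. (c' + d * u) * exp (K * u))"
    have c'0: "0 < c'" using c' init norm_ge_zero[of "e 0"] by linarith
    have gmono: "g u \<le> g b" if "0 \<le> u" "u \<le> b" for u
      unfolding g_def using that c'0 d K by (intro mult_mono add_mono mult_left_mono) (auto intro: mult_left_mono)
    have gcont: "continuous_on S g" for S
      unfolding g_def by (intro continuous_intros)
    define S where "S = {u\<in>{0..b}. g u \<le> norm (e u)}"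
    have S: "closed S" unfolding S_def
      by (rule continuous_on_closed_Collect_le)
        (auto intro!: continuous_intros cont gcont)
    have ne: "u \<in> S" using neg u by (auto simp: S_def g_def)
    have bdd: "bdd_below S" by (rule bdd_belowI[of _ 0]) (auto simp: S_def)
    define m where "m = Inf S"
    have mS: "m \<in> S" unfolding m_def by (rule closed_contains_Inf) (use S ne bdd in auto)
    have below: "norm (e v) < g v" if "0 \<le> v" "v < m" for v
    proof (rule ccontr)
      assume "\<not> ?thesis"
      then have "v \<in> S" using that mS by (auto simp: S_def)
      then have "m \<le> v" unfolding m_def by (rule cInf_lower) (rule bdd)
      with that show False by simp
    qed
    have "m \<noteq> 0" using mS c' init by (auto simp: S_def g_def)
    with mS have m: "0 < m" "m \<le> b" by (auto simp: S_def)
    \<comment> \<open>The derivative of \<open>g\<close>, which is at least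
      \<open>K * g + d\<close>. Before the first violation \<open>m\<close> the norm of
      \<open>e\<close> is below \<open>g\<close>, hence below \<open>r\<close>, so
      \<open>bound\<close> applies and \<open>e\<close> cannot move further than \<open>g\<close>
      grows. As \<open>e\<close> starts lower by at least \<open>c' - c\<close>, it cannot reach
      \<open>g\<close> at \<open>m\<close>.\<close>
    define g' where "g' = (\<lambda>u. (d + K * (c' + d * u)) * exp (K * u))"
    have "norm (e m - e 0) \<le> g m - g 0"
    proof (rule differentiable_bound_general)
      show "0 < m" by (rule m)
      show "continuous_on {0..m} e" using cont by (rule continuous_on_subset) (use m in auto)
      show "continuous_on {0..m} g" by (rule gcont)
      fix v :: real assume v: "0 < v" "v < m"
      show "(e has_vector_derivative e' v) (at v)" using v m by (intro deriv) auto
      show "(g has_vector_derivative g' v) (at v)"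
        unfolding g_def g'_def has_real_derivative_iff_has_vector_derivative[symmetric]
        by (auto intro!: derivative_eq_intros simp: algebra_simps)
      have lt: "norm (e v) < g v" using v by (intro below) auto
      also have "g v \<le> g b" using v m by (intro gmono) auto
      also have "\<dots> < r" using r' by (simp add: g_def)
      finally have "norm (e' v) \<le> K * norm (e v) + d" using v m by (intro bound) auto
      also have "\<dots> \<le> K * g v + d" using lt K by (intro add_mono mult_left_mono) auto
      also have "\<dots> \<le> K * g v + d * exp (K * v)"
        using mult_left_mono[of 1 "exp (K * v)" d] d K v by simp
      finally show "norm (e' v) \<le> g' v" by (simp add: g'_def g_def algebra_simps)
    qed
    moreover have "norm (e m) \<le> norm (e m - e 0) + norm (e 0)"
      using norm_triangle_ineq[of "e m - e 0" "e 0"] by simp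
    moreover have "g 0 = c'" by (simp add: g_def)
    ultimately show False using mS init c' by (auto simp: S_def)
  qed
  have "((\<lambda>c'. (c' + d * b) * exp (K * b)) \<longlongrightarrow> (c + d * b) * exp (K * b)) (at_right c)"
    by (intro tendsto_intros)
  then have ev: "\<forall>\<^sub>F c' in at_right c. (c' + d * b) * exp (K * b) < r"
    using r by (rule order_tendstoD)
  have ev2: "\<forall>\<^sub>F c' in at_right c. norm (e u) \<le> (c' + d * u) * exp (K * u)"
    using ev eventually_at_right_less[of c]
    by eventually_elim (use strict u in \<open>auto intro: less_imp_le\<close>)
  have lim: "((\<lambda>c'. (c' + d * u) * exp (K * u)) \<longlongrightarrow> (c + d * u) * exp (K * u)) (at_right c)"
    by (intro tendsto_intros)
  show ?thesis
    by (rule tendsto_lowerbound[OF lim ev2]) simp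
qed

section \<open>Existence for linear equations\<close>

text \<open>Picard iteration written as a series of increments \<open>w n\<close>: the first carries
  the initial value and the inhomogeneity, each later one is the integral of \<open>A\<close>
  applied to its predecessor. The product is an abstract bilinear map so that the unknown can be
  operator-valued, with composition as \<open>mul\<close>.\<close>

lemma linear_ode_solution:
  fixes A :: "real \<Rightarrow> 'c::real_normed_vector" and B :: "real \<Rightarrow> 'a::banach"
    and mul :: "'c \<Rightarrow> 'a \<Rightarrow> 'a"
  assumes bil: "bounded_bilinear mul" and ab: "a \<le> b"
    and A: "continuous_on {a..b} A" and B: "continuous_on {a..b} B"
  shows "\<exists>W. W a = W0 \<and>
    (\<forall>t\<in>{a..b}. (W has_vector_derivative mul (A t) (W t) + B t) (at t within {a..b}))"
proof -
  interpret bounded_bilinear mul by (rule bil)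
  obtain K0 where K0: "0 \<le> K0" "\<And>x y. norm (mul x y) \<le> norm x * norm y * K0"
    using nonneg_bounded by blast
  have "bounded (A ` {a..b})"
    using A by (intro compact_imp_bounded compact_continuous_image) auto
  then obtain KA where KA: "\<And>t. t \<in> {a..b} \<Longrightarrow> norm (A t) \<le> KA"
    unfolding bounded_iff by blast
  \<comment> \<open>The summand \<open>1\<close> keeps \<open>K\<close> positive, since
    \<open>e / K\<close> is needed as a tolerance below.\<close>
  define K where "K = \<bar>KA\<bar> * K0 + 1"
  have K: "0 < K" unfolding K_def using K0 by (intro add_nonneg_pos) auto
  have mulK: "norm (mul (A t) y) \<le> K * norm y" if "t \<in> {a..b}" for t y
  proof -
    have "norm (mul (A t) y) \<le> norm (A t) * norm y * K0" by (rule K0)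
    also have "\<dots> \<le> \<bar>KA\<bar> * norm y * K0"
      using KA[OF that] K0 by (intro mult_right_mono) auto
    also have "\<dots> \<le> K * norm y" by (simp add: K_def algebra_simps)
    finally show ?thesis .
  qed
  define w where "w = rec_nat (\<lambda>t. W0 + integral {a..t} B) (\<lambda>n f t. integral {a..t} (\<lambda>s. mul (A s) (f s)))"
  have w0: "w 0 t = W0 + integral {a..t} B" and wS: "w (Suc n) t = integral {a..t} (\<lambda>s. mul (A s) (w n s))" for n t
    by (simp_all add: w_def)
  define D where "D = (\<lambda>n. case n of 0 \<Rightarrow> B | Suc m \<Rightarrow> (\<lambda>s. mul (A s) (w m s)))"
  have wD: "continuous_on {a..b} (D n) \<and>
     (\<forall>t\<in>{a..b}. (w n has_vector_derivative D n t) (at t within {a..b}))" for n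
  proof (induction n)
    case 0
    have "((\<lambda>t. W0 + integral {a..t} B) has_vector_derivative D 0 t) (at t within {a..b})"
      if "t \<in> {a..b}" for t
      using integral_has_vector_derivative[OF B that]
      by (auto intro!: derivative_eq_intros simp: D_def)
    then show ?case using B by (simp add: D_def w_def)
  next
    case (Suc n)
    have "continuous_on {a..b} (w n)"
      using Suc by (intro continuous_on_vector_derivative) auto
    then have c: "continuous_on {a..b} (\<lambda>s. mul (A s) (w n s))"
      using A by (intro continuous_on) auto
    have "((\<lambda>t. integral {a..t} (\<lambda>s. mul (A s) (w n s))) has_vector_derivative D (Suc n) t) (at t within {a..b})"
      if "t \<in> {a..b}" for t
      using integral_has_vector_derivative[OF c that] by (simp add: D_def)
    then show ?case using c by (simp add: D_def w_def)
  qed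
  have wcont: "continuous_on {a..b} (w n)" for n
    by (rule continuous_on_vector_derivative) (use wD in blast)
  have "bounded (w 0 ` {a..b})"
    using wcont by (intro compact_imp_bounded compact_continuous_image) auto
  then obtain C0 where C0: "\<And>t. t \<in> {a..b} \<Longrightarrow> norm (w 0 t) \<le> C0"
    unfolding bounded_iff by blast
  have C00: "0 \<le> C0" using order_trans[OF norm_ge_zero C0[of a]] ab by simp
  \<comment> \<open>The weight \<open>exp (2 * K * (t - a))\<close> makes each Picard step gain a factor 1/2.\<close>
  have wbound: "norm (w n t) \<le> C0 * (1/2)^n * exp (2 * K * (t - a))" if "t \<in> {a..b}" for n t
    using that
  proof (induction n arbitrary: t)
    case 0
    have "norm (w 0 t) \<le> C0" using C0 0 by auto
    also have "C0 \<le> C0 * exp (2 * K * (t - a))"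
      using C00 K 0 by (simp add: mult_le_cancel_left1)
    finally show ?case by simp
  next
    case (Suc n)
    show ?case
    proof (cases "t = a")
      case True
      then show ?thesis using C00 by (simp add: wS)
    next
      case False
      with Suc have t: "a < t" "t \<le> b" by auto
      define \<phi> where "\<phi> = (\<lambda>t. C0 * (1/2)^Suc n * exp (2 * K * (t - a)))"
      have "norm (w (Suc n) t - w (Suc n) a) \<le> \<phi> t - \<phi> a"
      proof (rule differentiable_bound_general)
        show "a < t" by (rule t)
        show "continuous_on {a..t} (w (Suc n))"
          using wcont by (rule continuous_on_subset) (use t in auto)
        show "continuous_on {a..t} \<phi>" unfolding \<phi>_def by (intro continuous_intros)
        fix s assume s: "a < s" "s < t"
        have "(w (Suc n) has_vector_derivative D (Suc n) s) (at s within {a..b})"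
          using wD s t by auto
        then show "(w (Suc n) has_vector_derivative D (Suc n) s) (at s)"
          using s t at_within_Icc_at[of a s b] by simp
        show "(\<phi> has_vector_derivative 2 * K * \<phi> s) (at s)"
          unfolding \<phi>_def has_real_derivative_iff_has_vector_derivative[symmetric]
          by (auto intro!: derivative_eq_intros)
        have "norm (D (Suc n) s) \<le> K * norm (w n s)"
          using mulK s t by (auto simp: D_def)
        also have "\<dots> \<le> K * (C0 * (1/2)^n * exp (2 * K * (s - a)))"
          using Suc.IH[of s] s t K by (intro mult_left_mono) auto
        also have "\<dots> = 2 * K * \<phi> s" by (simp add: \<phi>_def)
        finally show "norm (D (Suc n) s) \<le> 2 * K * \<phi> s" .
      qed
      moreover have "w (Suc n) a = 0" by (simp add: wS)
      moreover have "0 \<le> \<phi> a" using C00 by (simp add: \<phi>_def)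
      ultimately have "norm (w (Suc n) t) \<le> \<phi> t" by simp
      then show ?thesis by (simp add: \<phi>_def)
    qed
  qed
  define W where "W = (\<lambda>t. suminf (\<lambda>n. w n t))"
  define E where "E = exp (2 * K * (b - a))"
  have wb: "norm (w n t) \<le> C0 * E * (1/2)^n" if "t \<in> {a..b}" for n t
  proof -
    have "norm (w n t) \<le> C0 * (1/2)^n * exp (2 * K * (t - a))" by (rule wbound[OF that])
    also have "\<dots> \<le> C0 * (1/2)^n * E"
      unfolding E_def using that C00 K by (intro mult_left_mono) auto
    finally show ?thesis by (simp add: mult_ac)
  qed
  have sm: "summable (\<lambda>n. C0 * E * (1/2::real)^n)"
    by (intro summable_mult summable_geometric) auto
  have ul: "uniform_limit {a..b} (\<lambda>n t. \<Sum>i<n. w i t) W sequentially"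
    unfolding W_def by (rule Weierstrass_m_test[OF _ sm]) (rule wb)
  have sums: "(\<lambda>n. w n t) sums W t" if "t \<in> {a..b}" for t
    unfolding W_def using summable_norm_cancel[OF summable_comparison_test'[OF sm]] wb that
    by (intro summable_sums) (auto intro!: summable_comparison_test'[OF sm])
  \<comment> \<open>The summed derivatives are the right-hand side at the previous partial sum.
    Uniform convergence of the \<open>w n\<close> series thus carries over to the derivatives, with
    the index shift that \<open>eventually_sequentially_Suc\<close> undoes.\<close>
  have sumD: "(\<Sum>i<Suc n. D i t) = B t + mul (A t) (\<Sum>i<n. w i t)" for n t
    by (induction n) (simp_all add: D_def add_right zero_right)
  have "\<exists>g. \<forall>t\<in>{a..b}. (\<lambda>n. w n t) sums g t \<and>
      (g has_derivative (\<lambda>h. h *\<^sub>R (mul (A t) (W t) + B t))) (at t within {a..b})"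
  proof (rule has_derivative_series)
    show "convex {a..b}" by simp
    show "(w n has_derivative (\<lambda>h. h *\<^sub>R D n t)) (at t within {a..b})" if "t \<in> {a..b}" for n t
      using wD that by (auto simp: has_vector_derivative_def)
    show "a \<in> {a..b}" using ab by simp
    show "(\<lambda>n. w n a) sums W a" using ab by (intro sums) simp
    fix e :: real assume e: "0 < e"
    have "\<forall>\<^sub>F n in sequentially. \<forall>t\<in>{a..b}. dist (\<Sum>i<n. w i t) (W t) < e / K"
      using ul e K by (auto simp: uniform_limit_iff)
    then have "\<forall>\<^sub>F n in sequentially. \<forall>t\<in>{a..b}. \<forall>h.
        norm ((\<Sum>i<Suc n. h *\<^sub>R D i t) - h *\<^sub>R (mul (A t) (W t) + B t)) \<le> e * norm h"
    proof eventually_elim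
      case (elim n)
      show ?case
      proof (intro ballI allI)
        fix t h assume t: "t \<in> {a..b}"
        have "(\<Sum>i<Suc n. h *\<^sub>R D i t) - h *\<^sub>R (mul (A t) (W t) + B t) =
            h *\<^sub>R mul (A t) ((\<Sum>i<n. w i t) - W t)"
          unfolding scaleR_sum_right[symmetric] sumD by (simp add: algebra_simps diff_right)
        also have "norm \<dots> \<le> \<bar>h\<bar> * (K * norm ((\<Sum>i<n. w i t) - W t))"
          using mulK[OF t] by (auto intro!: mult_left_mono)
        also have "\<dots> \<le> \<bar>h\<bar> * (K * (e / K))"
          using elim[rule_format, OF t] K by (intro mult_left_mono) (auto simp: dist_norm)
        finally show "norm ((\<Sum>i<Suc n. h *\<^sub>R D i t) - h *\<^sub>R (mul (A t) (W t) + B t)) \<le> e * norm h"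
          using K by (simp add: mult.commute)
      qed
    qed
    then show "\<forall>\<^sub>F n in sequentially. \<forall>t\<in>{a..b}. \<forall>h.
        norm ((\<Sum>i<n. h *\<^sub>R D i t) - h *\<^sub>R (mul (A t) (W t) + B t)) \<le> e * norm h"
      by (subst (asm) eventually_sequentially_Suc)
  qed
  then obtain g where g: "\<And>t. t \<in> {a..b} \<Longrightarrow> (\<lambda>n. w n t) sums g t"
    "\<And>t. t \<in> {a..b} \<Longrightarrow> (g has_vector_derivative (mul (A t) (W t) + B t)) (at t within {a..b})"
    unfolding has_vector_derivative_def by blast
  have gW: "g t = W t" if "t \<in> {a..b}" for t
    using g(1) sums that sums_unique2 by blast
  have "(\<lambda>n. w n a) sums W0"
  proof -
    have "w (Suc n) a = 0" for n by (simp add: wS)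
    then have "w n a = (if n = 0 then W0 else 0)" for n by (cases n) (auto simp: w0)
    then show ?thesis using sums_single[of 0 "\<lambda>_. W0"] by simp
  qed
  then have "g a = W0" using g(1)[of a] ab sums_unique2 by auto
  then show ?thesis using g(2) gW by (intro exI[of _ g]) simp
qed

section \<open>First-order dependence on parameter and end times\<close>

text \<open>The mean value inequality with uniform continuity of \<open>F'\<close>. Since
  \<open>z'\<close> need not lie in \<open>C\<close>, uniform continuity is taken on a compact
  thickening of \<open>C\<close> inside \<open>S\<close>.\<close>

lemma uniform_linearization:
  fixes F :: "'a::euclidean_space \<Rightarrow> 'b::real_normed_vector"
  assumes S: "open S" and F: "\<And>z. z \<in> S \<Longrightarrow> (F has_derivative blinfun_apply (F' z)) (at z)"
    and F': "continuous_on S F'" and C: "compact C" "C \<subseteq> S" and \<epsilon>: "0 < \<epsilon>"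
  obtains r where "0 < r"
    and "\<And>z z'. z \<in> C \<Longrightarrow> norm (z' - z) < r \<Longrightarrow>
      z' \<in> S \<and> norm (F z' - F z - F' z (z' - z)) \<le> \<epsilon> * norm (z' - z)"
proof -
  obtain e where e: "0 < e" "(\<Union>x\<in>C. cball x e) \<subseteq> S"
    using compact_subset_open_imp_cball_epsilon_subset[OF C(1) S C(2)] by blast
  define C' where "C' = (\<Union>x\<in>C. cball x e)"
  have C'S: "C' \<subseteq> S" using e by (simp add: C'_def)
  \<comment> \<open>Writing the thickening as a sum of two compact sets gives its
    compactness.\<close>
  have "C' = {x + y |x y. x \<in> C \<and> y \<in> cball 0 e}"
  proof (rule set_eqI)
    fix z
    show "z \<in> C' \<longleftrightarrow> z \<in> {x + y |x y. x \<in> C \<and> y \<in> cball 0 e}"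
      unfolding C'_def mem_Collect_eq UN_iff mem_cball dist_norm
      by (metis add_diff_cancel_left' diff_0 diff_add_cancel add.commute norm_minus_cancel norm_minus_commute) 
  qed
  then have "compact C'"
    using compact_sums[OF C(1) compact_cball[of 0 e]] by simp
  then have "uniformly_continuous_on C' F'"
    using e F' by (intro compact_uniformly_continuous) (auto simp: C'_def intro!: continuous_on_subset[OF F'])
  then obtain d where d: "0 < d" "\<And>z z'. z \<in> C' \<Longrightarrow> z' \<in> C' \<Longrightarrow> dist z' z < d \<Longrightarrow> dist (F' z') (F' z) < \<epsilon>"
    using \<epsilon> unfolding uniformly_continuous_on_def by blast
  show thesis
  proof (rule that)
    show "0 < min d e" using d e by simp
    fix z z' assume z: "z \<in> C" "norm (z' - z) < min d e"
    have inC': "y \<in> C'" if "norm (y - z) < min d e" for y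
      unfolding C'_def using that z(1) by (auto simp: dist_norm norm_minus_commute intro!: bexI[of _ z])
    have "norm (F z' - F z - F' z (z' - z)) \<le> norm (z' - z) * \<epsilon>"
    proof (rule differentiable_bound_linearization[where S = "ball z (min d e)" and f' = "\<lambda>x. blinfun_apply (F' x)"])
      fix t :: real assume t: "t \<in> {0..1}"
      have "norm (t *\<^sub>R (z' - z)) \<le> norm (z' - z)" using t by (simp add: mult_left_le_one_le)
      then show "z + t *\<^sub>R (z' - z) \<in> ball z (min d e)"
        using z by (auto simp: dist_norm norm_minus_commute)
    next
      fix x assume x: "x \<in> ball z (min d e)"
      then have x: "norm (x - z) < min d e" by (auto simp: dist_norm norm_minus_commute)
      have "x \<in> S" using inC'[OF x] C'S by blast
      then show "(F has_derivative blinfun_apply (F' x)) (at x within ball z (min d e))"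
        using F has_derivative_at_withinI by blast
      have "dist (F' x) (F' z) < \<epsilon>"
        using x inC'[OF x] inC'[of z] d e by (intro d(2)) (auto simp: dist_norm)
      then show "onorm (blinfun_apply (F' x) - blinfun_apply (F' z)) \<le> \<epsilon>"
        by (simp add: dist_norm norm_blinfun.rep_eq minus_blinfun.rep_eq fun_diff_def)
    next
      show "z \<in> ball z (min d e)" using d e by simp
    qed
    then show "z' \<in> S \<and> norm (F z' - F z - F' z (z' - z)) \<le> \<epsilon> * norm (z' - z)"
      using inC'[OF z(2)] C'S by (auto simp: mult.commute)
  qed
qed

text \<open>With \<open>nhds\<close> in place of a punctured filter, the estimate can be pulled back
  along maps that may hit the limit point, and it can be combined with statements that are also
  evaluated at the point itself.\<close>

lemma has_derivative_at_nhds: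
  "(f has_derivative f') (at x) \<longleftrightarrow> bounded_linear f' \<and>
     (\<forall>e>0. \<forall>\<^sub>F y in nhds x. norm (f y - f x - f' (y - x)) \<le> e * norm (y - x))"
  unfolding has_derivative_at_alt eventually_nhds_metric dist_norm by blast

text \<open>
  \<open>Z t\<close> is the derivative of the state at the fixed time \<open>t\<close>; the term
  \<open>(b - b0) *\<^sub>R F (w b0, \<theta>)\<close> accounts for the shift of the evaluation time. Hence no
  solution is ever continued beyond its own interval.
\<close>

lemma transport_first_order:
  fixes F :: "'a::euclidean_space \<times> 'p::euclidean_space \<Rightarrow> 'a"
    and Z :: "real \<Rightarrow> 'p \<Rightarrow>\<^sub>L 'a"
  assumes S: "open S" and F: "\<And>z. z \<in> S \<Longrightarrow> (F has_derivative blinfun_apply (F' z)) (at z)"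
    and F': "continuous_on S F'" and a0b0: "a0 < b0"
    and w: "continuous_on {a0..b0} w"
    and w': "\<And>t. a0 < t \<Longrightarrow> t < b0 \<Longrightarrow> (w has_vector_derivative F (w t, \<theta>)) (at t)"
    and wS: "\<And>t. t \<in> {a0..b0} \<Longrightarrow> (w t, \<theta>) \<in> S"
    and Z: "continuous_on {a0..b0} Z"
    and Z': "\<And>t h. a0 < t \<Longrightarrow> t < b0 \<Longrightarrow>
      ((\<lambda>t. Z t h) has_vector_derivative F' (w t, \<theta>) (Z t h, h)) (at t)"
    and \<epsilon>: "0 < \<epsilon>"
  obtains \<delta> where "0 < \<delta>"
    and "\<And>p a b v. a < b \<Longrightarrow> continuous_on {a..b} v \<Longrightarrow>
      (\<And>t. a < t \<Longrightarrow> t < b \<Longrightarrow> (v has_vector_derivative F (v t, p)) (at t)) \<Longrightarrow>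
      norm (p - \<theta>) + \<bar>a - a0\<bar> + \<bar>b - b0\<bar> < \<delta> \<Longrightarrow>
      norm (v a - w a0 - Z a0 (p - \<theta>) - (a - a0) *\<^sub>R F (w a0, \<theta>))
        \<le> \<delta> * (norm (p - \<theta>) + \<bar>a - a0\<bar> + \<bar>b - b0\<bar>) \<Longrightarrow>
      norm (v b - w b0 - Z b0 (p - \<theta>) - (b - b0) *\<^sub>R F (w b0, \<theta>))
        \<le> \<epsilon> * (norm (p - \<theta>) + \<bar>a - a0\<bar> + \<bar>b - b0\<bar>)"
proof -
  define f where "f = (\<lambda>t. F (w t, \<theta>))"
  define C where "C = (\<lambda>t. (w t, \<theta>)) ` {a0..b0}"
  have C: "compact C" "C \<subseteq> S" unfolding C_def
    using wS by (auto intro!: compact_continuous_image continuous_intros w)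
  have Fcont: "continuous_on S F"
    using F by (meson continuous_at_imp_continuous_on has_derivative_continuous)
  have fcont: "continuous_on {a0..b0} f" unfolding f_def
    using wS by (intro continuous_on_compose2[OF Fcont] continuous_intros w) auto
  \<comment> \<open>The velocity of an autonomous equation solves the linearized equation with zero
    parameter increment. This lets the time shift term of the expansion be transported like
    \<open>Z\<close>.\<close>
  have f': "(f has_vector_derivative F' (w t, \<theta>) (f t, 0)) (at t)" if t: "a0 < t" "t < b0" for t
  proof -
    have "((\<lambda>t. (w t, \<theta>)) has_vector_derivative (f t, 0)) (at t)"
      unfolding f_def using w'[OF t] by (auto intro!: derivative_eq_intros)
    moreover have "(F has_derivative blinfun_apply (F' (w t, \<theta>))) (at (w t, \<theta>))"
      using t by (intro F wS) auto
    ultimately show ?thesis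
      using vector_derivative_diff_chain_within[of "\<lambda>t. (w t, \<theta>)" "(f t, 0)" t UNIV F]
        has_derivative_at_withinI unfolding f_def o_def by blast
  qed
  have bdd: "\<exists>B. \<forall>t\<in>{a0..b0}. norm (g t) \<le> B" if "continuous_on {a0..b0} g"
    for g :: "real \<Rightarrow> 'b::real_normed_vector"
    using compact_imp_bounded[OF compact_continuous_image[OF that compact_Icc]]
    unfolding bounded_iff by blast
  have "continuous_on {a0..b0} (\<lambda>t. F' (w t, \<theta>))"
    using wS by (intro continuous_on_compose2[OF F'] continuous_intros w) auto
  from bdd[OF this] bdd[OF fcont] bdd[OF Z] obtain M1 M2 M3 where
    M123: "\<And>t. t \<in> {a0..b0} \<Longrightarrow> norm (F' (w t, \<theta>)) \<le> M1" "\<And>t. t \<in> {a0..b0} \<Longrightarrow> norm (f t) \<le> M2"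
      "\<And>t. t \<in> {a0..b0} \<Longrightarrow> norm (Z t) \<le> M3"
    by blast
  define M where "M = max 0 (max M1 (max M2 M3))"
  have M0: "0 \<le> M" by (simp add: M_def)
  have M: "norm (F' (w t, \<theta>)) \<le> M" "norm (f t) \<le> M" "norm (Z t) \<le> M" if "t \<in> {a0..b0}" for t
    using M123[OF that] by (auto simp: M_def)
  have F'M: "norm (F' (w t, \<theta>) y) \<le> M * norm y" if "t \<in> {a0..b0}" for t y
    using norm_blinfun[of "F' (w t, \<theta>)" y] mult_right_mono[OF M(1)[OF that] norm_ge_zero[of y]]
    by linarith
  have ZM: "norm (Z t y) \<le> M * norm y" if "t \<in> {a0..b0}" for t y
    using norm_blinfun[of "Z t" y] mult_right_mono[OF M(3)[OF that] norm_ge_zero[of y]]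
    by linarith
  define m0 where "m0 = b0 - a0"
  have m0: "0 < m0" using a0b0 by (simp add: m0_def)
  \<comment> \<open>On the rescaled unit interval, \<open>m0 + 1\<close> bounds the length of the
    perturbed segment and \<open>M + 1\<close> is the growth rate of \<open>F\<close> in the tube,
    \<open>M\<close> from the derivative and \<open>1\<close> from the linearization error.
    \<open>C1\<close> is the resulting Gronwall factor: initial error \<open>1 + 2 * M\<close>,
    inhomogeneity \<open>K1 + M\<close>. \<open>K2\<close> is the rate of the linearized equation,
    and \<open>G\<close> collects the coefficients of \<open>\<eta>\<close> in the final
    estimate.\<close>
  define K1 where "K1 = (m0 + 1) * (M + 1)"
  define C1 where "C1 = ((1 + 2 * M) + (K1 + M)) * exp K1"
  define K2 where "K2 = m0 * M"
  define G where "G = 1 + ((m0 + 1) + M) * (C1 + 1)"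
  define \<eta> where "\<eta> = \<epsilon> / (G * exp K2)"
  have K1: "0 < K1" using m0 M0 by (simp add: K1_def add_pos_nonneg)
  have C1: "0 < C1" using K1 M0 by (simp add: C1_def add_pos_nonneg)
  have K2: "0 \<le> K2" using m0 M0 by (simp add: K2_def)
  have G: "0 < G" unfolding G_def using m0 M0 C1 by (intro add_pos_nonneg mult_nonneg_nonneg) auto
  have \<eta>: "0 < \<eta>" using \<epsilon> G by (simp add: \<eta>_def)
  obtain r1 where r1: "0 < r1" "\<And>z z'. z \<in> C \<Longrightarrow> norm (z' - z) < r1 \<Longrightarrow>
      z' \<in> S \<and> norm (F z' - F z - F' z (z' - z)) \<le> 1 * norm (z' - z)"
    by (rule uniform_linearization[OF S F F' C, of 1]) auto
  obtain r2 where r2: "0 < r2" "\<And>z z'. z \<in> C \<Longrightarrow> norm (z' - z) < r2 \<Longrightarrow>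
      z' \<in> S \<and> norm (F z' - F z - F' z (z' - z)) \<le> \<eta> * norm (z' - z)"
    by (rule uniform_linearization[OF S F F' C \<eta>]) auto
  \<comment> \<open>The entries in turn: the perturbed length stays below \<open>m0 + 1\<close> and
    the initial error below \<open>\<kappa>\<close>; \<open>\<delta>\<close> can be replaced by
    \<open>\<eta>\<close> at the end; the parameter increment uses at most half of
    \<open>r1\<close>; the state difference uses at most the other half; state and parameter
    together stay within the finer radius \<open>r2\<close>.\<close>
  define \<delta> where "\<delta> = Min {1, \<eta>, r1 / 2, r1 / (2 * C1), r2 / (C1 + 1)}"
  have \<delta>0: "0 < \<delta>" unfolding \<delta>_def using \<eta> r1 r2 C1 by (simp add: field_simps)
  have \<delta>: "\<delta> \<le> 1" "\<delta> \<le> \<eta>" "\<delta> \<le> r1 / 2" "\<delta> \<le> r1 / (2 * C1)" "\<delta> \<le> r2 / (C1 + 1)"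
    unfolding \<delta>_def by (rule Min_le; simp)+
  show thesis
  proof (rule that[OF \<delta>0])
    fix p a b v
    define h where "h = p - \<theta>"
    define \<kappa> where "\<kappa> = norm h + \<bar>a - a0\<bar> + \<bar>b - b0\<bar>"
    assume ab: "a < b" and v: "continuous_on {a..b} v"
      and v': "\<And>t. a < t \<Longrightarrow> t < b \<Longrightarrow> (v has_vector_derivative F (v t, p)) (at t)"
      and "norm (p - \<theta>) + \<bar>a - a0\<bar> + \<bar>b - b0\<bar> < \<delta>"
      and "norm (v a - w a0 - Z a0 (p - \<theta>) - (a - a0) *\<^sub>R F (w a0, \<theta>))
        \<le> \<delta> * (norm (p - \<theta>) + \<bar>a - a0\<bar> + \<bar>b - b0\<bar>)"
    then have \<kappa>: "\<kappa> < \<delta>" and init: "norm (v a - w a0 - Z a0 h - (a - a0) *\<^sub>R f a0) \<le> \<delta> * \<kappa>"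
      by (simp_all add: h_def \<kappa>_def f_def)
    have \<kappa>0: "0 \<le> \<kappa>" by (simp add: \<kappa>_def)
    have \<kappa>s: "norm h \<le> \<kappa>" "\<bar>a - a0\<bar> \<le> \<kappa>" "\<bar>b - b0\<bar> \<le> \<kappa>" "\<bar>a - a0\<bar> + \<bar>b - b0\<bar> \<le> \<kappa>"
      by (simp_all add: \<kappa>_def)
    define m where "m = b - a"
    have mm0: "\<bar>m - m0\<bar> \<le> \<kappa>" using \<kappa>s(4) by (auto simp: m_def m0_def)
    have m: "0 < m" "m \<le> m0 + 1"
      using ab mm0 \<kappa> \<delta>(1) by (auto simp: m_def)
    define \<sigma> where "\<sigma> = (\<lambda>s. a + s * m)"
    define \<sigma>0 where "\<sigma>0 = (\<lambda>s. a0 + s * m0)"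
    \<comment> \<open>The clock difference at equal rescaled time, running affinely from
      \<open>a - a0\<close> to \<open>b - b0\<close>.\<close>
    define \<rho> where "\<rho> = (\<lambda>s. \<sigma> s - \<sigma>0 s)"
    have ends: "\<sigma> 0 = a" "\<sigma> 1 = b" "\<sigma>0 0 = a0" "\<sigma>0 1 = b0"
      by (simp_all add: \<sigma>_def \<sigma>0_def m_def m0_def)
    have \<sigma>: "\<sigma> s \<in> {a..b}" and \<sigma>0: "\<sigma>0 s \<in> {a0..b0}" if "s \<in> {0..1}" for s
      using that m m0 mult_left_le_one_le[of m s] mult_left_le_one_le[of m0 s]
      unfolding \<sigma>_def \<sigma>0_def atLeastAtMost_iff
      by (smt (verit, ccfv_threshold) mult_nonneg_nonneg m_def m0_def)+
    have \<sigma>i: "a < \<sigma> s" "\<sigma> s < b" and \<sigma>0i: "a0 < \<sigma>0 s" "\<sigma>0 s < b0" if "0 < s" "s < 1" for s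
      using mult_strict_right_mono[OF that(2) m(1)] mult_strict_right_mono[OF that(2) m0]
        mult_pos_pos[OF that(1) m(1)] mult_pos_pos[OF that(1) m0]
      by (simp_all add: \<sigma>_def \<sigma>0_def m_def m0_def)
    have \<sigma>': "(\<sigma> has_vector_derivative m) (at s)" "(\<sigma>0 has_vector_derivative m0) (at s)" for s
      unfolding \<sigma>_def \<sigma>0_def has_real_derivative_iff_has_vector_derivative[symmetric]
      by (auto intro!: derivative_eq_intros)
    have \<sigma>cont: "continuous_on X \<sigma>" "continuous_on X \<sigma>0" for X
      unfolding \<sigma>_def \<sigma>0_def by (intro continuous_intros)+
    define z where "z = (\<lambda>s. (w (\<sigma>0 s), \<theta>))"
    define z' where "z' = (\<lambda>s. (v (\<sigma> s), p))"
    have zC: "z s \<in> C" if "s \<in> {0..1}" for s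
      using \<sigma>0[OF that] by (auto simp: C_def z_def)
    define e where "e = (\<lambda>s. v (\<sigma> s) - w (\<sigma>0 s))"
    have zz: "z' s - z s = (e s, h)" for s by (simp add: z_def z'_def e_def h_def)
    have nzz: "norm (z' s - z s) \<le> norm (e s) + norm h" for s
      unfolding zz by (rule norm_Pair_le)
    have ve: "((\<lambda>s. v (\<sigma> s)) has_vector_derivative m *\<^sub>R F (z' s)) (at s)"
      and we: "((\<lambda>s. w (\<sigma>0 s)) has_vector_derivative m0 *\<^sub>R F (z s)) (at s)"
      and Ze: "((\<lambda>s. Z (\<sigma>0 s) h) has_vector_derivative m0 *\<^sub>R F' (z s) (Z (\<sigma>0 s) h, h)) (at s)"
      and fe: "((\<lambda>s. f (\<sigma>0 s)) has_vector_derivative m0 *\<^sub>R F' (z s) (f (\<sigma>0 s), 0)) (at s)"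
      if s: "0 < s" "s < 1" for s
      using vector_diff_chain_at[OF \<sigma>'(1) v'[OF \<sigma>i[OF s]]]
        vector_diff_chain_at[OF \<sigma>'(2) w'[OF \<sigma>0i[OF s]]]
        vector_diff_chain_at[OF \<sigma>'(2) Z'[OF \<sigma>0i[OF s], of h]]
        vector_diff_chain_at[OF \<sigma>'(2) f'[OF \<sigma>0i[OF s]]]
      by (simp_all add: o_def z_def z'_def)
    have vc: "continuous_on {0..1} (\<lambda>s. v (\<sigma> s))"
      by (rule continuous_on_compose2[OF v \<sigma>cont(1)]) (use \<sigma> in auto)
    have wc: "continuous_on {0..1} (\<lambda>s. w (\<sigma>0 s))"
      by (rule continuous_on_compose2[OF w \<sigma>cont(2)]) (use \<sigma>0 in auto)
    have Zc: "continuous_on {0..1} (\<lambda>s. Z (\<sigma>0 s))"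
      by (rule continuous_on_compose2[OF Z \<sigma>cont(2)]) (use \<sigma>0 in auto)
    have fc: "continuous_on {0..1} (\<lambda>s. f (\<sigma>0 s))"
      by (rule continuous_on_compose2[OF fcont \<sigma>cont(2)]) (use \<sigma>0 in auto)

    \<comment> \<open>first a Lipschitz bound that keeps the perturbed solution near the reference, then its linearization\<close>
    have e_bound: "norm (e s) \<le> ((1 + 2 * M) * \<kappa> + ((K1 + M) * \<kappa>) * s) * exp (K1 * s)"
      if "0 \<le> s" "s \<le> 1" for s
    proof (rule gronwall_tube[where b = 1 and r = "r1 / 2"])
      show "continuous_on {0..1} e" unfolding e_def by (intro continuous_intros vc wc)
      fix u :: real assume u: "0 < u" "u < 1"
      then have u01: "u \<in> {0..1}" by simp
      show "(e has_vector_derivative m *\<^sub>R F (z' u) - m0 *\<^sub>R F (z u)) (at u)"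
        unfolding e_def by (intro has_vector_derivative_diff ve we u)
      assume eu: "norm (e u) < r1 / 2"
      have lt: "norm (z' u - z u) < r1"
        using nzz[of u] eu \<kappa>s(1) \<kappa> \<delta>(3) by linarith
      have "F (z' u) - F (z u) = (F (z' u) - F (z u) - F' (z u) (z' u - z u)) + F' (z u) (z' u - z u)"
        by simp
      then have "norm (F (z' u) - F (z u)) \<le> norm (z' u - z u) + M * norm (z' u - z u)"
        using norm_triangle_ineq[of "F (z' u) - F (z u) - F' (z u) (z' u - z u)" "F' (z u) (z' u - z u)"]
          r1(2)[OF zC[OF u01] lt] F'M[OF \<sigma>0[OF u01], of "z' u - z u"]
        by (auto simp: z_def)
      also have "\<dots> = (M + 1) * norm (z' u - z u)" by (simp add: algebra_simps)
      also have "\<dots> \<le> (M + 1) * (norm (e u) + \<kappa>)"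
        using nzz[of u] \<kappa>s(1) M0 by (intro mult_left_mono) auto
      finally have dF: "norm (F (z' u) - F (z u)) \<le> (M + 1) * (norm (e u) + \<kappa>)" .
      have "m *\<^sub>R F (z' u) - m0 *\<^sub>R F (z u) = m *\<^sub>R (F (z' u) - F (z u)) + (m - m0) *\<^sub>R F (z u)"
        by (simp add: algebra_simps)
      also have "norm \<dots> \<le> m * norm (F (z' u) - F (z u)) + \<bar>m - m0\<bar> * norm (F (z u))"
        using m norm_triangle_ineq[of "m *\<^sub>R (F (z' u) - F (z u))" "(m - m0) *\<^sub>R F (z u)"] by simp
      also have "\<dots> \<le> (m0 + 1) * ((M + 1) * (norm (e u) + \<kappa>)) + \<kappa> * M"
        using dF m mm0 M(2)[OF \<sigma>0[OF u01]] m0 M0 \<kappa>0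
        by (intro add_mono mult_mono) (auto simp: z_def f_def)
      also have "\<dots> = K1 * norm (e u) + (K1 + M) * \<kappa>" by (simp add: K1_def algebra_simps)
      finally show "norm (m *\<^sub>R F (z' u) - m0 *\<^sub>R F (z u)) \<le> K1 * norm (e u) + (K1 + M) * \<kappa>" .
    next
      have a0in: "a0 \<in> {a0..b0}" using a0b0 by simp
      have "e 0 = (v a - w a0 - Z a0 h - (a - a0) *\<^sub>R f a0) + (Z a0 h + (a - a0) *\<^sub>R f a0)"
        by (simp add: e_def ends)
      then have "norm (e 0) \<le> norm (v a - w a0 - Z a0 h - (a - a0) *\<^sub>R f a0) + (norm (Z a0 h) + norm ((a - a0) *\<^sub>R f a0))"
        by (metis norm_triangle_le norm_triangle_ineq add_left_mono order_refl norm_triangle_mono)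
      also have "\<dots> \<le> 1 * \<kappa> + (M * \<kappa> + \<kappa> * M)"
      proof (intro add_mono)
        show "norm (v a - w a0 - Z a0 h - (a - a0) *\<^sub>R f a0) \<le> 1 * \<kappa>"
          using init mult_right_mono[OF \<delta>(1) \<kappa>0] by linarith
        show "norm (Z a0 h) \<le> M * \<kappa>"
          using ZM[OF a0in, of h] mult_left_mono[OF \<kappa>s(1) M0] by linarith
        show "norm ((a - a0) *\<^sub>R f a0) \<le> \<kappa> * M"
          using M(2)[OF a0in] \<kappa>s(2) \<kappa>0 by (auto intro!: mult_mono)
      qed
      also have "\<dots> = (1 + 2 * M) * \<kappa>" by (simp add: algebra_simps)
      finally show "norm (e 0) \<le> (1 + 2 * M) * \<kappa>" .
      have "((1 + 2 * M) * \<kappa> + (K1 + M) * \<kappa> * 1) * exp (K1 * 1) = C1 * \<kappa>"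
        by (simp add: C1_def algebra_simps)
      also have "\<dots> < C1 * \<delta>" using C1 \<kappa> by simp
      also have "\<dots> \<le> C1 * (r1 / (2 * C1))" using C1 \<delta>(4) by (intro mult_left_mono) auto
      also have "\<dots> = r1 / 2" using C1 by simp
      finally show "((1 + 2 * M) * \<kappa> + (K1 + M) * \<kappa> * 1) * exp (K1 * 1) < r1 / 2" .
    qed (use that K1 M0 \<kappa>0 in auto)
    have eC1: "norm (e s) \<le> C1 * \<kappa>" if s: "0 \<le> s" "s \<le> 1" for s
    proof -
      have "norm (e s) \<le> ((1 + 2 * M) * \<kappa> + ((K1 + M) * \<kappa>) * s) * exp (K1 * s)"
        by (rule e_bound[OF s])
      also have "\<dots> \<le> ((1 + 2 * M) * \<kappa> + ((K1 + M) * \<kappa>) * 1) * exp (K1 * 1)"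
        using s K1 M0 \<kappa>0 by (intro mult_mono add_mono mult_left_mono add_nonneg_nonneg mult_nonneg_nonneg) auto
      also have "\<dots> = C1 * \<kappa>" by (simp add: C1_def algebra_simps)
      finally show ?thesis .
    qed
    have zzC1: "norm (z' s - z s) \<le> (C1 + 1) * \<kappa>" if s: "0 \<le> s" "s \<le> 1" for s
      using nzz[of s] eC1[OF s] \<kappa>s(1) by (simp add: algebra_simps)

    \<comment> \<open>The error of the expansion at every rescaled time: at \<open>0\<close> it is
      the assumed initial error, at \<open>1\<close> the claimed one. Its derivative is
      \<open>m0 *\<^sub>R F' (z s) (e2 s, 0)\<close> plus two terms bounded together by
      \<open>d2\<close>: the linearization remainder, with factor \<open>\<eta>\<close>, and the
      effect of \<open>m - m0\<close>, with factor \<open>\<delta> * M\<close>.\<close>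
    define e2 where "e2 = (\<lambda>s. v (\<sigma> s) - w (\<sigma>0 s) - Z (\<sigma>0 s) h - \<rho> s *\<^sub>R f (\<sigma>0 s))"
    define d2 where "d2 = ((m0 + 1) * \<eta> + \<delta> * M) * ((C1 + 1) * \<kappa>)"
    have d2: "0 \<le> d2" unfolding d2_def using m0 \<eta> \<delta>0 M0 C1 \<kappa>0 by (intro mult_nonneg_nonneg add_nonneg_nonneg) auto
    have \<rho>': "(\<rho> has_vector_derivative (m - m0)) (at s)" for s
      unfolding \<rho>_def by (intro has_vector_derivative_diff \<sigma>')
    have "norm (e2 1) \<le> (\<delta> * \<kappa> + d2 * 1) * exp (K2 * 1)"
    \<comment> \<open>\<open>r\<close> only has to exceed the final value: closeness to the
      reference comes from \<open>zzC1\<close>, not from a tube around \<open>e2\<close>.\<close>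
    proof (rule gronwall_tube[where b = 1 and r = "(\<delta> * \<kappa> + d2 * 1) * exp (K2 * 1) + 1"])
      show "continuous_on {0..1} e2" unfolding e2_def \<rho>_def
        by (intro continuous_intros vc wc Zc fc \<sigma>cont)
      fix u :: real assume u: "0 < u" "u < 1"
      then have u01: "u \<in> {0..1}" by simp
      let ?D = "m *\<^sub>R F (z' u) - m0 *\<^sub>R F (z u) - m0 *\<^sub>R F' (z u) (Z (\<sigma>0 u) h, h)
        - (\<rho> u *\<^sub>R (m0 *\<^sub>R F' (z u) (f (\<sigma>0 u), 0)) + (m - m0) *\<^sub>R f (\<sigma>0 u))"
      show "(e2 has_vector_derivative ?D) (at u)"
        unfolding e2_def
        by (intro has_vector_derivative_diff ve we Ze u
            has_vector_derivative_scaleR[OF \<rho>'[folded has_real_derivative_iff_has_vector_derivative] fe[OF u]])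
      have fz: "f (\<sigma>0 u) = F (z u)" by (simp add: f_def z_def)
      have "(e2 u, 0) = (z' u - z u) - (Z (\<sigma>0 u) h, h) - \<rho> u *\<^sub>R (f (\<sigma>0 u), 0)"
        by (simp add: zz e_def e2_def)
      then have lin: "F' (z u) (e2 u, 0) = F' (z u) (z' u - z u) - F' (z u) (Z (\<sigma>0 u) h, h)
          - \<rho> u *\<^sub>R F' (z u) (f (\<sigma>0 u), 0)"
        by (simp only: blinfun.diff_right blinfun.scaleR_right)
      have "?D = m *\<^sub>R (F (z' u) - F (z u) - F' (z u) (z' u - z u))
          + (m - m0) *\<^sub>R F' (z u) (z' u - z u) + m0 *\<^sub>R F' (z u) (e2 u, 0)"
        unfolding lin fz by (simp add: algebra_simps)
      also have "norm \<dots> \<le> m * norm (F (z' u) - F (z u) - F' (z u) (z' u - z u))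
          + \<bar>m - m0\<bar> * norm (F' (z u) (z' u - z u)) + m0 * norm (F' (z u) (e2 u, 0))"
        using m m0 by (intro order_trans[OF norm_triangle_ineq] add_mono) auto
      also have "\<dots> \<le> (m0 + 1) * (\<eta> * ((C1 + 1) * \<kappa>)) + \<delta> * (M * ((C1 + 1) * \<kappa>)) + m0 * (M * norm (e2 u))"
      proof (intro add_mono mult_mono)
        have "norm (z' u - z u) \<le> (C1 + 1) * \<kappa>" using zzC1 u by simp
        also have "\<dots> < (C1 + 1) * (r2 / (C1 + 1))" using \<kappa> \<delta>(5) C1 by (intro mult_strict_left_mono) auto
        also have "\<dots> = r2" using C1 by simp
        finally have "norm (z' u - z u) < r2" .
        from r2(2)[OF zC[OF u01] this]
        have "norm (F (z' u) - F (z u) - F' (z u) (z' u - z u)) \<le> \<eta> * norm (z' u - z u)" by simp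
        also have "\<dots> \<le> \<eta> * ((C1 + 1) * \<kappa>)" using \<eta> zzC1[of u] u by (intro mult_left_mono) auto
        finally show "norm (F (z' u) - F (z u) - F' (z u) (z' u - z u)) \<le> \<eta> * ((C1 + 1) * \<kappa>)" .
        have "norm (F' (z u) (z' u - z u)) \<le> M * norm (z' u - z u)"
          using F'M[OF \<sigma>0[OF u01]] by (simp add: z_def)
        also have "\<dots> \<le> M * ((C1 + 1) * \<kappa>)" using M0 zzC1[of u] u by (intro mult_left_mono) auto
        finally show "norm (F' (z u) (z' u - z u)) \<le> M * ((C1 + 1) * \<kappa>)" .
        show "norm (F' (z u) (e2 u, 0)) \<le> M * norm (e2 u)"
          using F'M[OF \<sigma>0[OF u01], of "(e2 u, 0)"] by (simp add: z_def norm_Pair)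
      qed (use m m0 mm0 \<kappa> \<delta>0 in auto)
      also have "\<dots> = K2 * norm (e2 u) + d2" by (simp add: K2_def d2_def algebra_simps)
      finally show "norm ?D \<le> K2 * norm (e2 u) + d2" .
    next
      show "norm (e2 0) \<le> \<delta> * \<kappa>" using init by (simp add: e2_def \<rho>_def ends)
    qed (use K2 d2 in auto)
    also have "\<dots> = (\<delta> + ((m0 + 1) * \<eta> + \<delta> * M) * (C1 + 1)) * exp K2 * \<kappa>"
      by (simp add: d2_def algebra_simps)
    also have "\<dots> \<le> (\<eta> + ((m0 + 1) * \<eta> + \<eta> * M) * (C1 + 1)) * exp K2 * \<kappa>"
      using \<delta>(2) M0 C1 \<kappa>0 \<eta> by (intro mult_right_mono add_mono) auto
    also have "\<dots> = \<eta> * (G * exp K2) * \<kappa>" by (simp add: G_def algebra_simps)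
    also have "\<dots> = \<epsilon> * \<kappa>" using G by (simp add: \<eta>_def)
    finally show "norm (v b - w b0 - Z b0 (p - \<theta>) - (b - b0) *\<^sub>R F (w b0, \<theta>))
        \<le> \<epsilon> * (norm (p - \<theta>) + \<bar>a - a0\<bar> + \<bar>b - b0\<bar>)"
      by (simp add: e2_def \<rho>_def ends h_def \<kappa>_def f_def)
  qed
qed

text \<open>The value of an arc at an event time is arbitrary. Filling in the one-sided limits
  yields the continuous function on a closed interval that \<open>transport_first_order\<close> asks
  for.\<close>

lemma continuous_on_Icc_extension:
  fixes v :: "real \<Rightarrow> 'a::topological_space"
  assumes ab: "a < b" and v: "\<And>t. a < t \<Longrightarrow> t < b \<Longrightarrow> isCont v t"
    and l: "(v \<longlongrightarrow> l) (at_right a)" and r: "(v \<longlongrightarrow> r) (at_left b)"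
  shows "continuous_on {a..b} (\<lambda>t. if t \<le> a then l else if b \<le> t then r else v t)"
    (is "continuous_on _ ?w")
proof (rule continuous_on_IccI)
  have eqr: "\<forall>\<^sub>F t in at_right a. ?w t = v t"
    using eventually_at_right_real[OF ab] by eventually_elim auto
  show "(?w \<longlongrightarrow> ?w a) (at_right a)"
    using l by (simp add: tendsto_cong[OF eqr])
  have eql: "\<forall>\<^sub>F t in at_left b. ?w t = v t"
    using eventually_at_left_real[OF ab] by eventually_elim auto
  show "(?w \<longlongrightarrow> ?w b) (at_left b)"
    using r ab by (simp add: tendsto_cong[OF eql])
  fix t assume t: "a < t" "t < b"
  have "\<forall>\<^sub>F s in nhds t. s \<in> {a<..<b}" using t by (intro eventually_nhds_in_open) auto
  then have "\<forall>\<^sub>F s in at t. ?w s = v s"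
    unfolding eventually_at_filter by eventually_elim auto
  then show "?w \<midarrow>t\<rightarrow> ?w t"
    using v[OF t] t by (simp add: tendsto_cong isCont_def)
qed (rule ab)

text \<open>The variational equation is solved once for operators and increments are inserted
  afterwards, so that one \<open>Z\<close> serves all directions and is itself differentiable in
  time. The end time \<open>\<beta>\<close> is merely continuous because this expansion is what
  later yields its derivative.\<close>

lemma segment_sensitivity:
  fixes F :: "'a::euclidean_space \<times> 'p::euclidean_space \<Rightarrow> 'a"
    and v :: "'p \<Rightarrow> real \<Rightarrow> 'a"
  assumes S: "open S" and F: "\<And>z. z \<in> S \<Longrightarrow> (F has_derivative blinfun_apply (F' z)) (at z)"
    and F': "continuous_on S F'"
    and ab: "\<alpha> \<theta> < b"
    and v': "\<And>t. \<alpha> \<theta> < t \<Longrightarrow> t < b \<Longrightarrow> (v \<theta> has_vector_derivative F (v \<theta> t, \<theta>)) (at t)"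
    and vS: "\<And>t. \<alpha> \<theta> < t \<Longrightarrow> t < b \<Longrightarrow> (v \<theta> t, \<theta>) \<in> S"
    and start: "(v \<theta> \<longlongrightarrow> y \<theta>) (at_right (\<alpha> \<theta>))" "(y \<theta>, \<theta>) \<in> S"
    and stop: "(v \<theta> \<longlongrightarrow> r) (at_left b)" "(r, \<theta>) \<in> S"
    and D\<alpha>: "(\<alpha> has_derivative D\<alpha>) (at \<theta>)" and Dy: "(y has_derivative Dy) (at \<theta>)"
  obtains Z :: "real \<Rightarrow> 'p \<Rightarrow>\<^sub>L 'a"
  where "continuous_on {\<alpha> \<theta>..b} Z"
    and "\<And>h. Z (\<alpha> \<theta>) h = Dy h - D\<alpha> h *\<^sub>R F (y \<theta>, \<theta>)"
    and "\<And>t. \<alpha> \<theta> < t \<Longrightarrow> t < b \<Longrightarrow> \<exists>Zd. (Z has_vector_derivative Zd) (at t) \<and>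
      (\<forall>h. Zd h = F' (v \<theta> t, \<theta>) (Z t h, h))"
    \<comment> \<open>for constant \<open>\<beta>\<close> this is differentiability at a fixed time; for an event time
      \<open>\<beta>\<close> it is the expansion of the state at the event\<close>
    and "\<And>\<beta> X \<epsilon>. \<alpha> \<theta> < \<beta> \<theta> \<Longrightarrow> \<beta> \<theta> \<le> b \<Longrightarrow> isCont \<beta> \<theta> \<Longrightarrow>
      \<forall>\<^sub>F \<phi> in nhds \<theta>. \<alpha> \<phi> < \<beta> \<phi> \<and>
        (\<forall>t\<in>{\<alpha> \<phi><..<\<beta> \<phi>}. (v \<phi> has_vector_derivative F (v \<phi> t, \<phi>)) (at t)) \<and>
        (v \<phi> \<longlongrightarrow> y \<phi>) (at_right (\<alpha> \<phi>)) \<and> (v \<phi> \<longlongrightarrow> X \<phi>) (at_left (\<beta> \<phi>)) \<Longrightarrow>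
      0 < \<epsilon> \<Longrightarrow>
      \<forall>\<^sub>F \<phi> in nhds \<theta>.
        norm (X \<phi> - X \<theta> - Z (\<beta> \<theta>) (\<phi> - \<theta>) - (\<beta> \<phi> - \<beta> \<theta>) *\<^sub>R F (X \<theta>, \<theta>))
          \<le> \<epsilon> * (norm (\<phi> - \<theta>) + \<bar>\<beta> \<phi> - \<beta> \<theta>\<bar>)"
proof -
  define w where "w = (\<lambda>t. if t \<le> \<alpha> \<theta> then y \<theta> else if b \<le> t then r else v \<theta> t)"
  have wv: "w t = v \<theta> t" if "\<alpha> \<theta> < t" "t < b" for t using that by (simp add: w_def)
  have w_ends: "w (\<alpha> \<theta>) = y \<theta>" "w b = r" using ab by (auto simp: w_def)
  have wcont: "continuous_on {\<alpha> \<theta>..b} w"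
    unfolding w_def
    by (rule continuous_on_Icc_extension[OF ab _ start(1) stop(1)])
      (metis v' has_vector_derivative_continuous)
  have w': "(w has_vector_derivative F (w t, \<theta>)) (at t)" if t: "\<alpha> \<theta> < t" "t < b" for t
    unfolding wv[OF t]
    by (rule has_vector_derivative_transform_within_open[OF v'[OF t], of "{\<alpha> \<theta><..<b}"])
      (use t in \<open>auto simp: wv\<close>)
  have wS: "(w t, \<theta>) \<in> S" if "t \<in> {\<alpha> \<theta>..b}" for t
    using that start stop vS by (auto simp: w_def)
  \<comment> \<open>Composing \<open>F'\<close> with the two embeddings gives the partial
    derivatives in state and parameter as operators, the coefficients of the variational
    equation.\<close>
  define ix where "ix = Blinfun (\<lambda>x::'a. (x, 0::'p))"
  define ip where "ip = Blinfun (\<lambda>p::'p. (0::'a, p))"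
  have ix: "blinfun_apply ix x = (x, 0)" and ip: "blinfun_apply ip p = (0, p)" for x p
    unfolding ix_def ip_def
    by (simp_all add: bounded_linear_Blinfun_apply bounded_linear_Pair bounded_linear_ident bounded_linear_zero)
  have F'cont: "continuous_on {\<alpha> \<theta>..b} (\<lambda>t. F' (w t, \<theta>))"
    using wS by (intro continuous_on_compose2[OF F'] continuous_intros wcont) auto
  have blZ0: "bounded_linear (\<lambda>h. Dy h - D\<alpha> h *\<^sub>R F (y \<theta>, \<theta>))"
    by (intro bounded_linear_sub bounded_linear_compose[OF bounded_linear_scaleR_left]
        has_derivative_bounded_linear[OF Dy] has_derivative_bounded_linear[OF D\<alpha>])
  obtain Z where Z0: "Z (\<alpha> \<theta>) = Blinfun (\<lambda>h. Dy h - D\<alpha> h *\<^sub>R F (y \<theta>, \<theta>))"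
    and Z': "\<And>t. t \<in> {\<alpha> \<theta>..b} \<Longrightarrow> (Z has_vector_derivative
        ((F' (w t, \<theta>) o\<^sub>L ix) o\<^sub>L Z t) + (F' (w t, \<theta>) o\<^sub>L ip)) (at t within {\<alpha> \<theta>..b})"
    using linear_ode_solution[OF bounded_bilinear_blinfun_compose less_imp_le[OF ab]
        bounded_bilinear.continuous_on[OF bounded_bilinear_blinfun_compose F'cont continuous_on_const[of _ ix]]
        bounded_bilinear.continuous_on[OF bounded_bilinear_blinfun_compose F'cont continuous_on_const[of _ ip]]]
    by blast
  have Z0': "Z (\<alpha> \<theta>) h = Dy h - D\<alpha> h *\<^sub>R F (y \<theta>, \<theta>)" for h
    unfolding Z0 by (simp add: bounded_linear_Blinfun_apply[OF blZ0])
  have Zcont: "continuous_on {\<alpha> \<theta>..b} Z"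
    by (rule continuous_on_vector_derivative) (rule Z')
  have Zat: "(Z has_vector_derivative ((F' (w t, \<theta>) o\<^sub>L ix) o\<^sub>L Z t) + (F' (w t, \<theta>) o\<^sub>L ip)) (at t)"
    if "\<alpha> \<theta> < t" "t < b" for t
    using Z'[of t] that at_within_Icc_at[of "\<alpha> \<theta>" t b] by simp
  have rhs: "(((F' (w t, \<theta>) o\<^sub>L ix) o\<^sub>L Z t) + (F' (w t, \<theta>) o\<^sub>L ip)) h = F' (w t, \<theta>) (Z t h, h)" for t h
    by (simp add: blinfun.add_left ix ip blinfun.add_right[symmetric])
  have Zh: "((\<lambda>t. Z t h) has_vector_derivative F' (w t, \<theta>) (Z t h, h)) (at t)"
    if "\<alpha> \<theta> < t" "t < b" for t h
    using bounded_linear.has_vector_derivative[OF blinfun.bounded_linear_left Zat[OF that], of h]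
    by (simp only: rhs)
  show thesis
  proof (rule that[OF Zcont Z0'])
    show "\<exists>Zd. (Z has_vector_derivative Zd) (at t) \<and> (\<forall>h. Zd h = F' (v \<theta> t, \<theta>) (Z t h, h))"
      if t: "\<alpha> \<theta> < t" "t < b" for t
      using Zat[OF t] rhs wv[OF t] by metis
  next
    fix \<beta> :: "'p \<Rightarrow> real" and X \<epsilon>
    assume \<beta>: "\<alpha> \<theta> < \<beta> \<theta>" "\<beta> \<theta> \<le> b" and \<beta>cont: "isCont \<beta> \<theta>"
      and ev: "\<forall>\<^sub>F \<phi> in nhds \<theta>. \<alpha> \<phi> < \<beta> \<phi> \<and>
        (\<forall>t\<in>{\<alpha> \<phi><..<\<beta> \<phi>}. (v \<phi> has_vector_derivative F (v \<phi> t, \<phi>)) (at t)) \<and>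
        (v \<phi> \<longlongrightarrow> y \<phi>) (at_right (\<alpha> \<phi>)) \<and> (v \<phi> \<longlongrightarrow> X \<phi>) (at_left (\<beta> \<phi>))"
      and \<epsilon>: "(0::real) < \<epsilon>"
    \<comment> \<open>\<open>X \<theta>\<close> is known only as a left limit, and
      \<open>\<beta> \<theta>\<close> may be interior or equal to \<open>b\<close>; left continuity
      of \<open>w\<close> covers both.\<close>
    have wX: "w (\<beta> \<theta>) = X \<theta>"
    proof -
      have "((\<lambda>t. w t) \<longlongrightarrow> w (\<beta> \<theta>)) (at_left (\<beta> \<theta>))"
        using continuous_on_Icc_at_leftD[OF continuous_on_subset[OF wcont, of "{\<alpha> \<theta>..\<beta> \<theta>}"] \<beta>(1)] \<beta> by auto
      moreover have "\<forall>\<^sub>F t in at_left (\<beta> \<theta>). w t = v \<theta> t"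
        using eventually_at_left_real[OF \<beta>(1)] by eventually_elim (use \<beta> in \<open>auto simp: wv\<close>)
      ultimately have "(v \<theta> \<longlongrightarrow> w (\<beta> \<theta>)) (at_left (\<beta> \<theta>))" by (simp add: tendsto_cong)
      moreover have "(v \<theta> \<longlongrightarrow> X \<theta>) (at_left (\<beta> \<theta>))"
        using eventually_nhds_x_imp_x[OF ev] by blast
      ultimately show ?thesis by (rule tendsto_unique[rotated]) simp
    qed
    obtain KA where KA: "0 \<le> KA" "\<And>h. norm (D\<alpha> h) \<le> norm h * KA"
      using bounded_linear.nonneg_bounded[OF has_derivative_bounded_linear[OF D\<alpha>]] by blast
    \<comment> \<open>Differentiability of \<open>\<alpha>\<close> bounds its increment by
      \<open>(KA + 1) * norm (\<phi> - \<theta>)\<close> near \<theta>. With the parameter increment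
      itself this makes \<open>KA + 2\<close>.\<close>
    define \<epsilon>' where "\<epsilon>' = \<epsilon> / (KA + 2)"
    have \<epsilon>': "0 < \<epsilon>'" using \<epsilon> KA by (simp add: \<epsilon>'_def)
    let ?\<kappa> = "\<lambda>\<phi>. norm (\<phi> - \<theta>) + \<bar>\<alpha> \<phi> - \<alpha> \<theta>\<bar> + \<bar>\<beta> \<phi> - \<beta> \<theta>\<bar>"
    obtain \<delta> where \<delta>: "0 < \<delta>" and tr: "\<And>p a b v. a < b \<Longrightarrow> continuous_on {a..b} v \<Longrightarrow>
      (\<And>t. a < t \<Longrightarrow> t < b \<Longrightarrow> (v has_vector_derivative F (v t, p)) (at t)) \<Longrightarrow>
      norm (p - \<theta>) + \<bar>a - \<alpha> \<theta>\<bar> + \<bar>b - \<beta> \<theta>\<bar> < \<delta> \<Longrightarrow>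
      norm (v a - w (\<alpha> \<theta>) - Z (\<alpha> \<theta>) (p - \<theta>) - (a - \<alpha> \<theta>) *\<^sub>R F (w (\<alpha> \<theta>), \<theta>))
        \<le> \<delta> * (norm (p - \<theta>) + \<bar>a - \<alpha> \<theta>\<bar> + \<bar>b - \<beta> \<theta>\<bar>) \<Longrightarrow>
      norm (v b - w (\<beta> \<theta>) - Z (\<beta> \<theta>) (p - \<theta>) - (b - \<beta> \<theta>) *\<^sub>R F (w (\<beta> \<theta>), \<theta>))
        \<le> \<epsilon>' * (norm (p - \<theta>) + \<bar>a - \<alpha> \<theta>\<bar> + \<bar>b - \<beta> \<theta>\<bar>)"
    proof (rule transport_first_order[OF S F F' \<beta>(1), of w \<theta> Z \<epsilon>'])
      show "continuous_on {\<alpha> \<theta>..\<beta> \<theta>} w" "continuous_on {\<alpha> \<theta>..\<beta> \<theta>} Z"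
        using \<beta> by (auto intro: continuous_on_subset[OF wcont] continuous_on_subset[OF Zcont])
    qed (use \<beta> w' wS Zh \<epsilon>' in auto)
    have \<alpha>lim: "(\<alpha> \<longlongrightarrow> \<alpha> \<theta>) (nhds \<theta>)"
      using has_derivative_continuous[OF D\<alpha>] by (simp add: isCont_def tendsto_at_iff_tendsto_nhds)
    have \<beta>lim: "(\<beta> \<longlongrightarrow> \<beta> \<theta>) (nhds \<theta>)"
      using \<beta>cont by (simp add: isCont_def tendsto_at_iff_tendsto_nhds)
    have "(?\<kappa> \<longlongrightarrow> norm (\<theta> - \<theta>) + \<bar>\<alpha> \<theta> - \<alpha> \<theta>\<bar> + \<bar>\<beta> \<theta> - \<beta> \<theta>\<bar>) (nhds \<theta>)"
      by (intro tendsto_intros \<alpha>lim \<beta>lim filterlim_ident)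
    then have \<kappa>small: "\<forall>\<^sub>F \<phi> in nhds \<theta>. ?\<kappa> \<phi> < \<delta>"
      using \<delta> by (intro order_tendstoD) auto
    define f where "f = F (y \<theta>, \<theta>)"
    \<comment> \<open>The initial error consists of the remainder of \<open>y\<close> and that of
      \<open>\<alpha>\<close> multiplied by the velocity \<open>f\<close>, whence the factor
      \<open>1 + norm f\<close>.\<close>
    define \<delta>' where "\<delta>' = \<delta> / (1 + norm f)"
    have f1: "0 < 1 + norm f" by (simp add: add_pos_nonneg)
    have \<delta>': "0 < \<delta>'" using \<delta> f1 by (simp add: \<delta>'_def)
    have yev: "\<forall>\<^sub>F \<phi> in nhds \<theta>. norm (y \<phi> - y \<theta> - Dy (\<phi> - \<theta>)) \<le> \<delta>' * norm (\<phi> - \<theta>)"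
      and \<alpha>ev: "\<forall>\<^sub>F \<phi> in nhds \<theta>. norm (\<alpha> \<phi> - \<alpha> \<theta> - D\<alpha> (\<phi> - \<theta>)) \<le> \<delta>' * norm (\<phi> - \<theta>)"
      and \<alpha>ev1: "\<forall>\<^sub>F \<phi> in nhds \<theta>. norm (\<alpha> \<phi> - \<alpha> \<theta> - D\<alpha> (\<phi> - \<theta>)) \<le> 1 * norm (\<phi> - \<theta>)"
      using Dy D\<alpha> \<delta>' zero_less_one by (auto simp only: has_derivative_at_nhds)
    from ev \<kappa>small yev \<alpha>ev \<alpha>ev1
    show "\<forall>\<^sub>F \<phi> in nhds \<theta>.
        norm (X \<phi> - X \<theta> - Z (\<beta> \<theta>) (\<phi> - \<theta>) - (\<beta> \<phi> - \<beta> \<theta>) *\<^sub>R F (X \<theta>, \<theta>))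
          \<le> \<epsilon> * (norm (\<phi> - \<theta>) + \<bar>\<beta> \<phi> - \<beta> \<theta>\<bar>)"
    proof eventually_elim
      case (elim \<phi>)
      define u where "u = (\<lambda>t. if t \<le> \<alpha> \<phi> then y \<phi> else if \<beta> \<phi> \<le> t then X \<phi> else v \<phi> t)"
      have \<alpha>\<beta>: "\<alpha> \<phi> < \<beta> \<phi>" using elim by blast
      have uv: "u t = v \<phi> t" if "\<alpha> \<phi> < t" "t < \<beta> \<phi>" for t using that by (simp add: u_def)
      have u_ends: "u (\<alpha> \<phi>) = y \<phi>" "u (\<beta> \<phi>) = X \<phi>" using \<alpha>\<beta> by (auto simp: u_def)
      have v\<phi>: "(v \<phi> has_vector_derivative F (v \<phi> t, \<phi>)) (at t)" if "\<alpha> \<phi> < t" "t < \<beta> \<phi>" for t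
        using elim(1) that by auto
      have "continuous_on {\<alpha> \<phi>..\<beta> \<phi>} u"
        unfolding u_def
        by (rule continuous_on_Icc_extension[OF \<alpha>\<beta>])
          (use elim(1) v\<phi> in \<open>auto intro: has_vector_derivative_continuous\<close>)
      moreover have "(u has_vector_derivative F (u t, \<phi>)) (at t)" if t: "\<alpha> \<phi> < t" "t < \<beta> \<phi>" for t
        unfolding uv[OF t]
        by (rule has_vector_derivative_transform_within_open[OF v\<phi>[OF t], of "{\<alpha> \<phi><..<\<beta> \<phi>}"])
          (use t in \<open>auto simp: uv\<close>)
      moreover have "norm (u (\<alpha> \<phi>) - w (\<alpha> \<theta>) - Z (\<alpha> \<theta>) (\<phi> - \<theta>) - (\<alpha> \<phi> - \<alpha> \<theta>) *\<^sub>R F (w (\<alpha> \<theta>), \<theta>))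
        \<le> \<delta> * ?\<kappa> \<phi>"
      proof -
        have "u (\<alpha> \<phi>) - w (\<alpha> \<theta>) - Z (\<alpha> \<theta>) (\<phi> - \<theta>) - (\<alpha> \<phi> - \<alpha> \<theta>) *\<^sub>R F (w (\<alpha> \<theta>), \<theta>)
          = (y \<phi> - y \<theta> - Dy (\<phi> - \<theta>)) - (\<alpha> \<phi> - \<alpha> \<theta> - D\<alpha> (\<phi> - \<theta>)) *\<^sub>R f"
          by (simp add: u_ends w_ends Z0' f_def algebra_simps)
        also have "norm \<dots> \<le> \<delta>' * norm (\<phi> - \<theta>) + (\<delta>' * norm (\<phi> - \<theta>)) * norm f"
          using elim(3) mult_right_mono[OF elim(4) norm_ge_zero[of f]]
          by (intro order_trans[OF norm_triangle_ineq4 add_mono]) simp_all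
        also have "\<dots> = (\<delta>' * (1 + norm f)) * norm (\<phi> - \<theta>)" by (simp add: algebra_simps)
        also have "\<delta>' * (1 + norm f) = \<delta>" using f1 by (simp add: \<delta>'_def)
        also have "\<delta> * norm (\<phi> - \<theta>) \<le> \<delta> * ?\<kappa> \<phi>" using \<delta> by (intro mult_left_mono) auto
        finally show ?thesis .
      qed
      ultimately have "norm (u (\<beta> \<phi>) - w (\<beta> \<theta>) - Z (\<beta> \<theta>) (\<phi> - \<theta>) - (\<beta> \<phi> - \<beta> \<theta>) *\<^sub>R F (w (\<beta> \<theta>), \<theta>))
          \<le> \<epsilon>' * ?\<kappa> \<phi>"
        using elim(2) by (intro tr \<alpha>\<beta>)
      also have "?\<kappa> \<phi> \<le> (KA + 2) * (norm (\<phi> - \<theta>) + \<bar>\<beta> \<phi> - \<beta> \<theta>\<bar>)"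
      proof -
        have "\<bar>\<alpha> \<phi> - \<alpha> \<theta>\<bar> \<le> norm (\<phi> - \<theta>) + norm (\<phi> - \<theta>) * KA"
          using elim(5) KA(2)[of "\<phi> - \<theta>"] by simp
        moreover have "0 \<le> \<bar>\<beta> \<phi> - \<beta> \<theta>\<bar> * (KA + 1)" using KA by simp
        ultimately show ?thesis by (simp add: algebra_simps)
      qed
      then have "\<epsilon>' * ?\<kappa> \<phi> \<le> \<epsilon>' * ((KA + 2) * (norm (\<phi> - \<theta>) + \<bar>\<beta> \<phi> - \<beta> \<theta>\<bar>))"
        using \<epsilon>' by (intro mult_left_mono) auto
      also have "\<dots> = \<epsilon> * (norm (\<phi> - \<theta>) + \<bar>\<beta> \<phi> - \<beta> \<theta>\<bar>)" using KA by (simp add: \<epsilon>'_def)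
      finally show ?case by (simp add: u_ends wX)
    qed
  qed
qed

section \<open>Events\<close>

text \<open>Inserting the expansion of \<open>X\<close> into \<open>G = 0\<close> gives
  \<open>c * \<delta> + G' (0, Z h)\<close> as a small multiple of
  \<open>norm h + \<bar>\<delta>\<bar>\<close>, where \<open>\<delta>\<close> is the increment of
  the event time. As \<open>c\<close> is nonzero, this first shows that \<open>\<delta>\<close> is
  at most a multiple of \<open>norm h\<close>, and then that the error is small relative to
  \<open>norm h\<close> alone. The branch \<open>\<tau>\<close> is given and continuous, so only its
  derivative has to be found.\<close>

lemma event_time_has_derivative:
  fixes \<tau> :: "'p::real_normed_vector \<Rightarrow> real" and X :: "'p \<Rightarrow> 'a::real_normed_vector"
    and G :: "real \<times> 'a \<Rightarrow> real"
  assumes cont: "isCont \<tau> \<theta>"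
    and X: "\<And>\<epsilon>. 0 < \<epsilon> \<Longrightarrow> \<forall>\<^sub>F \<phi> in nhds \<theta>.
      norm (X \<phi> - X \<theta> - Z (\<phi> - \<theta>) - (\<tau> \<phi> - \<tau> \<theta>) *\<^sub>R f) \<le> \<epsilon> * (norm (\<phi> - \<theta>) + \<bar>\<tau> \<phi> - \<tau> \<theta>\<bar>)"
    and Z: "bounded_linear Z"
    and G: "(G has_derivative G') (at (\<tau> \<theta>, X \<theta>))"
    and zero: "\<forall>\<^sub>F \<phi> in nhds \<theta>. G (\<tau> \<phi>, X \<phi>) = 0"
    and c: "G' (1, f) \<noteq> 0"
  shows "(\<tau> has_derivative (\<lambda>h. - G' (0, Z h) / G' (1, f))) (at \<theta>)" (is ?th1)
    and "(X has_derivative (\<lambda>h. Z h + (- G' (0, Z h) / G' (1, f)) *\<^sub>R f)) (at \<theta>)" (is ?th2)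
proof -
  interpret Z: bounded_linear Z by (rule Z)
  have blG: "bounded_linear G'" using G by (rule has_derivative_bounded_linear)
  interpret G': bounded_linear G' by (rule blG)
  obtain MZ where MZ: "0 \<le> MZ" "\<And>h. norm (Z h) \<le> norm h * MZ" using Z.nonneg_bounded by blast
  obtain MG where MG: "0 \<le> MG" "\<And>y. norm (G' y) \<le> norm y * MG" using G'.nonneg_bounded by blast
  define \<delta> where "\<delta> = (\<lambda>\<phi>. \<tau> \<phi> - \<tau> \<theta>)"
  define D where "D = (\<lambda>\<phi>. X \<phi> - X \<theta>)"
  define \<kappa> where "\<kappa> = (\<lambda>\<phi>. norm (\<phi> - \<theta>) + \<bar>\<delta> \<phi>\<bar>)"
  define c where "c = G' (1, f)"
  have c0: "c \<noteq> 0" using c by (simp add: c_def)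
  have \<kappa>0: "0 \<le> \<kappa> \<phi>" "\<bar>\<delta> \<phi>\<bar> \<le> \<kappa> \<phi>" "norm (\<phi> - \<theta>) \<le> \<kappa> \<phi>" for \<phi> by (simp_all add: \<kappa>_def)
  have X': "\<forall>\<^sub>F \<phi> in nhds \<theta>. norm (D \<phi> - Z (\<phi> - \<theta>) - \<delta> \<phi> *\<^sub>R f) \<le> \<epsilon> * \<kappa> \<phi>" if "0 < \<epsilon>" for \<epsilon>
    using X[OF that] by (simp add: D_def \<delta>_def \<kappa>_def)
  define C where "C = MZ + norm f + 1"
  have C: "0 < C" using MZ by (simp add: C_def add_nonneg_pos)
  \<comment> \<open>The expansion with factor \<open>1\<close> is enough here. The bound also gives
    continuity of \<open>X\<close> at \<theta>, which places
    \<open>(\<tau> \<phi>, X \<phi>)\<close> where the derivative of \<open>G\<close> can be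
    used.\<close>
  have DC: "\<forall>\<^sub>F \<phi> in nhds \<theta>. norm (D \<phi>) \<le> C * \<kappa> \<phi>"
    using X'[OF zero_less_one]
  proof eventually_elim
    case (elim \<phi>)
    have "D \<phi> = (D \<phi> - Z (\<phi> - \<theta>) - \<delta> \<phi> *\<^sub>R f) + (Z (\<phi> - \<theta>) + \<delta> \<phi> *\<^sub>R f)" by simp
    then have "norm (D \<phi>) \<le> norm (D \<phi> - Z (\<phi> - \<theta>) - \<delta> \<phi> *\<^sub>R f) + (norm (Z (\<phi> - \<theta>)) + norm (\<delta> \<phi> *\<^sub>R f))"
      by (metis norm_triangle_ineq norm_triangle_mono order_refl)
    also have "\<dots> \<le> 1 * \<kappa> \<phi> + (\<kappa> \<phi> * MZ + \<kappa> \<phi> * norm f)"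
      using elim MZ(2)[of "\<phi> - \<theta>"] mult_right_mono[OF \<kappa>0(3) MZ(1), of \<phi>] mult_right_mono[OF \<kappa>0(2)[of \<phi>] norm_ge_zero[of f]]
      by (intro add_mono) auto
    finally show ?case by (simp add: C_def algebra_simps)
  qed
  have \<tau>lim: "(\<tau> \<longlongrightarrow> \<tau> \<theta>) (nhds \<theta>)" using cont by (simp add: isCont_def tendsto_at_iff_tendsto_nhds)
  have \<delta>lim: "(\<delta> \<longlongrightarrow> 0) (nhds \<theta>)" unfolding \<delta>_def using tendsto_diff[OF \<tau>lim tendsto_const[of "\<tau> \<theta>"]] by simp
  have hlim: "((\<lambda>\<phi>. norm (\<phi> - \<theta>)) \<longlongrightarrow> 0) (nhds \<theta>)"
    using tendsto_norm[OF tendsto_diff[OF filterlim_ident tendsto_const[of \<theta>]], of \<theta>] by simp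
  have \<kappa>lim: "(\<kappa> \<longlongrightarrow> 0) (nhds \<theta>)"
    unfolding \<kappa>_def using tendsto_add[OF hlim tendsto_rabs_zero[OF \<delta>lim]] by simp
  have Dlim: "(D \<longlongrightarrow> 0) (nhds \<theta>)"
    by (rule Lim_null_comparison[OF DC]) (use tendsto_mult_right_zero[OF \<kappa>lim] in auto)
  have Xlim: "(X \<longlongrightarrow> X \<theta>) (nhds \<theta>)"
    using tendsto_add[OF Dlim tendsto_const[of "X \<theta>"]] by (simp add: D_def)
  have Plim: "((\<lambda>\<phi>. (\<tau> \<phi>, X \<phi>)) \<longlongrightarrow> (\<tau> \<theta>, X \<theta>)) (nhds \<theta>)" by (intro tendsto_Pair \<tau>lim Xlim)
  have zero\<theta>: "G (\<tau> \<theta>, X \<theta>) = 0" using eventually_nhds_x_imp_x[OF zero] .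
  have key: "\<forall>\<^sub>F \<phi> in nhds \<theta>. \<bar>c * \<delta> \<phi> + G' (0, Z (\<phi> - \<theta>))\<bar> \<le> \<epsilon> * \<kappa> \<phi>" if \<epsilon>: "0 < \<epsilon>" for \<epsilon>
  proof -
    \<comment> \<open>Each remainder may use half of \<open>\<epsilon>\<close>: that of
      \<open>G\<close>, whose argument moves by at most \<open>(1 + C) * \<kappa> \<phi>\<close>,
      and that of \<open>X\<close> after passing through \<open>G'\<close>. \<open>MG + 1\<close>
      avoids division by zero.\<close>
    define \<epsilon>1 where "\<epsilon>1 = \<epsilon> / (2 * (1 + C))"
    define \<epsilon>2 where "\<epsilon>2 = \<epsilon> / (2 * (MG + 1))"
    have \<epsilon>1: "0 < \<epsilon>1" using \<epsilon> C by (simp add: \<epsilon>1_def)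
    have \<epsilon>2: "0 < \<epsilon>2" using \<epsilon> MG by (simp add: \<epsilon>2_def)
    have "\<forall>\<^sub>F y in nhds (\<tau> \<theta>, X \<theta>). norm (G y - G (\<tau> \<theta>, X \<theta>) - G' (y - (\<tau> \<theta>, X \<theta>))) \<le> \<epsilon>1 * norm (y - (\<tau> \<theta>, X \<theta>))"
      using G \<epsilon>1 by (simp add: has_derivative_at_nhds)
    from eventually_compose_filterlim[OF this Plim]
    have "\<forall>\<^sub>F \<phi> in nhds \<theta>. norm (G (\<tau> \<phi>, X \<phi>) - G' (\<delta> \<phi>, D \<phi>)) \<le> \<epsilon>1 * norm (\<delta> \<phi>, D \<phi>)"
      by (simp add: zero\<theta> \<delta>_def D_def)
    with zero DC X'[OF \<epsilon>2] show ?thesis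
    proof eventually_elim
      case (elim \<phi>)
      have "(\<delta> \<phi>, D \<phi>) = \<delta> \<phi> *\<^sub>R (1, f) + (0, Z (\<phi> - \<theta>)) + (0, D \<phi> - Z (\<phi> - \<theta>) - \<delta> \<phi> *\<^sub>R f)"
        by simp
      then have "G' (\<delta> \<phi>, D \<phi>) = \<delta> \<phi> * c + G' (0, Z (\<phi> - \<theta>)) + G' (0, D \<phi> - Z (\<phi> - \<theta>) - \<delta> \<phi> *\<^sub>R f)"
        unfolding c_def by (simp only: G'.add G'.scaleR real_scaleR_def)
      moreover have "\<bar>G' (\<delta> \<phi>, D \<phi>)\<bar> \<le> \<epsilon>1 * ((1 + C) * \<kappa> \<phi>)"
      proof -
        have "norm (\<delta> \<phi>, D \<phi>) \<le> (1 + C) * \<kappa> \<phi>"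
          using norm_Pair_le[of "\<delta> \<phi>" "D \<phi>"] elim(2) \<kappa>0(2)[of \<phi>] by (simp add: algebra_simps)
        then have "\<epsilon>1 * norm (\<delta> \<phi>, D \<phi>) \<le> \<epsilon>1 * ((1 + C) * \<kappa> \<phi>)" using \<epsilon>1 by simp
        then show ?thesis using elim(1,4) by simp
      qed
      moreover have "\<bar>G' (0, D \<phi> - Z (\<phi> - \<theta>) - \<delta> \<phi> *\<^sub>R f)\<bar> \<le> (\<epsilon>2 * \<kappa> \<phi>) * MG"
        using MG(2)[of "(0, D \<phi> - Z (\<phi> - \<theta>) - \<delta> \<phi> *\<^sub>R f)"] mult_right_mono[OF elim(3) MG(1)]
        by (simp add: norm_Pair)
      moreover have "(\<epsilon>2 * \<kappa> \<phi>) * MG \<le> \<epsilon> / 2 * \<kappa> \<phi>"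
      proof -
        have "\<epsilon>2 * MG \<le> \<epsilon>2 * (MG + 1)" using \<epsilon>2 by simp
        also have "\<dots> = \<epsilon> / 2" using MG by (simp add: \<epsilon>2_def field_simps)
        finally show ?thesis using mult_right_mono[of "\<epsilon>2 * MG" "\<epsilon> / 2" "\<kappa> \<phi>"] \<kappa>0 by (simp add: mult_ac)
      qed
      moreover have "\<epsilon>1 * ((1 + C) * \<kappa> \<phi>) = \<epsilon> / 2 * \<kappa> \<phi>" using C by (simp add: \<epsilon>1_def field_simps)
      ultimately show ?case unfolding mult.commute[of c "\<delta> \<phi>"] by linarith
    qed
  qed
  define L where "L = (\<lambda>h. - G' (0, Z h) / c)"
  have blL: "bounded_linear L"
  proof -
    have "bounded_linear (\<lambda>h. G' (0, Z h))"
      by (intro bounded_linear_compose[OF blG] bounded_linear_Pair bounded_linear_zero Z)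
    then have "bounded_linear (\<lambda>h. (- 1 / c) * G' (0, Z h))" by (rule bounded_linear_const_mult)
    then show ?thesis by (simp add: L_def)
  qed
  \<comment> \<open>Applying \<open>key\<close> with tolerance \<open>\<bar>c\<bar> / 2\<close>
    leaves at most half of \<open>\<bar>c\<bar> * \<bar>\<delta> \<phi>\<bar>\<close> on the right.
    Absorbing it on the left and doubling gives this constant.\<close>
  define C2 where "C2 = 2 * (MG * MZ) / \<bar>c\<bar> + 1"
  have C2: "0 < C2" using MG MZ by (simp add: C2_def add_nonneg_pos)
  have c2: "0 < \<bar>c\<bar> / 2" using c0 by simp
  have \<delta>C2: "\<forall>\<^sub>F \<phi> in nhds \<theta>. \<bar>\<delta> \<phi>\<bar> \<le> C2 * norm (\<phi> - \<theta>)"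
    using key[OF c2]
  proof eventually_elim
    case (elim \<phi>)
    have "\<bar>G' (0, Z (\<phi> - \<theta>))\<bar> \<le> norm (Z (\<phi> - \<theta>)) * MG"
      using MG(2)[of "(0, Z (\<phi> - \<theta>))"] by (simp add: norm_Pair)
    also have "\<dots> \<le> norm (\<phi> - \<theta>) * MZ * MG" using MZ MG by (intro mult_right_mono) auto
    finally have "\<bar>c * \<delta> \<phi>\<bar> \<le> norm (\<phi> - \<theta>) * MZ * MG + \<bar>c\<bar> * \<kappa> \<phi> / 2"
      using elim by (simp only: times_divide_eq_left)
    then have "\<bar>c\<bar> * \<bar>\<delta> \<phi>\<bar> \<le> norm (\<phi> - \<theta>) * MZ * MG + \<bar>c\<bar> * (norm (\<phi> - \<theta>) + \<bar>\<delta> \<phi>\<bar>) / 2"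
      by (simp add: abs_mult \<kappa>_def)
    moreover have "\<bar>c\<bar> * (C2 * norm (\<phi> - \<theta>)) = 2 * (norm (\<phi> - \<theta>) * MZ * MG) + \<bar>c\<bar> * norm (\<phi> - \<theta>)"
      using c0 by (simp add: C2_def algebra_simps)
    ultimately have "\<bar>c\<bar> * \<bar>\<delta> \<phi>\<bar> \<le> \<bar>c\<bar> * (C2 * norm (\<phi> - \<theta>))"
      by (simp only: distrib_left add_divide_distrib)
    then show ?case using c0 by simp
  qed
  have \<tau>L: "\<forall>\<^sub>F \<phi> in nhds \<theta>. \<bar>\<delta> \<phi> - L (\<phi> - \<theta>)\<bar> \<le> \<epsilon> * norm (\<phi> - \<theta>)" if \<epsilon>: "0 < \<epsilon>" for \<epsilon>
  proof -
    have "0 < \<epsilon> * \<bar>c\<bar> / (1 + C2)" using \<epsilon> c0 C2 by simp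
    from key[OF this] \<delta>C2 show ?thesis
    proof eventually_elim
      case (elim \<phi>)
      have "\<bar>c\<bar> * \<bar>\<delta> \<phi> - L (\<phi> - \<theta>)\<bar> = \<bar>c * \<delta> \<phi> + G' (0, Z (\<phi> - \<theta>))\<bar>"
        using c0 by (simp add: L_def abs_mult[symmetric] algebra_simps)
      also have "\<dots> \<le> \<epsilon> * \<bar>c\<bar> / (1 + C2) * \<kappa> \<phi>" by (rule elim)
      also have "\<dots> \<le> \<epsilon> * \<bar>c\<bar> / (1 + C2) * ((1 + C2) * norm (\<phi> - \<theta>))"
        using elim(2) \<epsilon> C2 by (intro mult_left_mono) (auto simp: \<kappa>_def algebra_simps)
      also have "\<dots> = \<bar>c\<bar> * (\<epsilon> * norm (\<phi> - \<theta>))" using C2 by (simp add: field_simps)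
      finally show ?case using c0 by simp
    qed
  qed
  show ?th1
    using \<tau>L blL by (simp add: has_derivative_at_nhds L_def c_def \<delta>_def)
  have blX: "bounded_linear (\<lambda>h. Z h + L h *\<^sub>R f)"
    by (intro bounded_linear_add Z bounded_linear_compose[OF bounded_linear_scaleR_left blL])
  have "\<forall>\<^sub>F \<phi> in nhds \<theta>. norm (X \<phi> - X \<theta> - (Z (\<phi> - \<theta>) + L (\<phi> - \<theta>) *\<^sub>R f)) \<le> \<epsilon> * norm (\<phi> - \<theta>)"
    if \<epsilon>: "0 < \<epsilon>" for \<epsilon>
  proof -
    \<comment> \<open>Again halves of \<open>\<epsilon>\<close>: for the remainder of
      \<open>X\<close>, where \<open>\<kappa> \<phi>\<close> is now at most
      \<open>(1 + C2) * norm (\<phi> - \<theta>)\<close>, and for the remainder of the event time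
      multiplied by \<open>f\<close>.\<close>
    define \<epsilon>1 where "\<epsilon>1 = \<epsilon> / (2 * (1 + C2))"
    define \<epsilon>2 where "\<epsilon>2 = \<epsilon> / (2 * (1 + norm f))"
    have \<epsilon>1: "0 < \<epsilon>1" using \<epsilon> C2 by (simp add: \<epsilon>1_def)
    have f1: "0 < 1 + norm f" by (simp add: add_pos_nonneg)
    have \<epsilon>2: "0 < \<epsilon>2" using \<epsilon> f1 by (simp add: \<epsilon>2_def)
    from X'[OF \<epsilon>1] \<tau>L[OF \<epsilon>2] \<delta>C2 show ?thesis
    proof eventually_elim
      case (elim \<phi>)
      have "X \<phi> - X \<theta> - (Z (\<phi> - \<theta>) + L (\<phi> - \<theta>) *\<^sub>R f) =
          (D \<phi> - Z (\<phi> - \<theta>) - \<delta> \<phi> *\<^sub>R f) + (\<delta> \<phi> - L (\<phi> - \<theta>)) *\<^sub>R f"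
        by (simp add: D_def algebra_simps)
      also have "norm \<dots> \<le> \<epsilon>1 * \<kappa> \<phi> + (\<epsilon>2 * norm (\<phi> - \<theta>)) * (1 + norm f)"
        using elim(1,2) \<epsilon>2 by (intro norm_triangle_le add_mono) (auto intro!: mult_mono mult_nonneg_nonneg)
      also have "\<dots> \<le> \<epsilon>1 * ((1 + C2) * norm (\<phi> - \<theta>)) + (\<epsilon>2 * norm (\<phi> - \<theta>)) * (1 + norm f)"
        using elim(3) \<epsilon>1 by (intro add_right_mono mult_left_mono) (auto simp: \<kappa>_def algebra_simps)
      also have "\<epsilon>1 * ((1 + C2) * norm (\<phi> - \<theta>)) = \<epsilon> / 2 * norm (\<phi> - \<theta>)"
        using C2 by (simp add: \<epsilon>1_def field_simps)
      also have "\<epsilon>2 * norm (\<phi> - \<theta>) * (1 + norm f) = \<epsilon> / 2 * norm (\<phi> - \<theta>)"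
        using f1 by (simp add: \<epsilon>2_def field_simps)
      finally show ?case by simp
    qed
  qed
  then show ?th2
    using blX by (simp add: has_derivative_at_nhds L_def c_def)
qed

section \<open>Partial derivatives as matrices\<close>

lemma linear_matrix_mult_vec:
  fixes f :: "real ^ 'p \<Rightarrow> real ^ 'n"
  assumes "linear f"
  shows "matrix f *v h = f h"
  using matrix_works[of f h] assms by (simp add: linear_def scalar_mult_eq_scaleR)

lemma matrix_blinfun_mult_vec:
  fixes B :: "(real ^ 'p) \<Rightarrow>\<^sub>L (real ^ 'n)"
  shows "matrix (blinfun_apply B) *v h = B h"
  by (intro linear_matrix_mult_vec bounded_linear.linear blinfun.bounded_linear_right)

text \<open>This transfers time derivatives and one-sided limits from the operators
  \<open>Z t\<close> to the sensitivity matrices.\<close>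

lemma bounded_linear_matrix_blinfun:
  "bounded_linear (\<lambda>B :: (real ^ 'p) \<Rightarrow>\<^sub>L (real ^ 'n). matrix (blinfun_apply B))"
proof (rule bounded_linear_intro)
  fix B :: "(real ^ 'p) \<Rightarrow>\<^sub>L (real ^ 'n)"
  have "norm (matrix (blinfun_apply B)) \<le> (\<Sum>i\<in>(UNIV::'n set). \<Sum>j\<in>(UNIV::'p set). \<bar>B (axis j 1) $ i\<bar>)"
    unfolding norm_vec_def[of "matrix (blinfun_apply B)"]
    by (intro order_trans[OF L2_set_le_sum] sum_mono order_trans[OF norm_le_l1_cart])
      (auto simp: matrix_def)
  also have "\<dots> \<le> (\<Sum>i\<in>(UNIV::'n set). \<Sum>j\<in>(UNIV::'p set). norm B)"
  proof (intro sum_mono)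
    fix i :: 'n and j :: 'p
    have "\<bar>B (axis j 1) $ i\<bar> \<le> norm (B (axis j 1))" by (rule component_le_norm_cart)
    also have "\<dots> \<le> norm B * norm (axis j (1::real))" by (rule norm_blinfun)
    finally show "\<bar>B (axis j 1) $ i\<bar> \<le> norm B" by simp
  qed
  also have "\<dots> = norm B * (real CARD('n) * real CARD('p))" by simp
  finally show "norm (matrix (blinfun_apply B)) \<le> norm B * (real CARD('n) * real CARD('p))" .
qed (simp_all add: matrix_def vec_eq_iff blinfun.add_left blinfun.scaleR_left)

lemma jacobian_eq_matrix:
  assumes "(f has_derivative f') (at x)"
  shows "jacobian f (at x) = matrix f'"
  using frechet_derivative_at[OF assms] by (simp add: jacobian_def)

lemma jacobian_mult_vec:
  fixes f :: "real ^ 'p \<Rightarrow> real ^ 'n"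
  assumes "(f has_derivative f') (at x)"
  shows "jacobian f (at x) *v h = f' h"
  using jacobian_eq_matrix[OF assms] has_derivative_linear[OF assms] by (simp add: linear_matrix_mult_vec)

text \<open>The action of the rank-one term of the saltation matrix.\<close>

lemma columnvector_mult_row:
  fixes u :: "real ^ 'n" and A :: "real ^ 'm ^ 1"
  shows "(columnvector u ** A) *v y = ((A *v y) $ 1) *\<^sub>R u"
  by (simp add: matrix_vector_mul_assoc[symmetric])
    (simp add: vec_eq_iff columnvector_def matrix_vector_mult_def)

lemma left_lim_eq: "(y \<longlongrightarrow> l) (at_left s) \<Longrightarrow> left_lim y s = l"
  unfolding left_lim_def by (rule tendsto_Lim) simp

lemma right_lim_eq: "(y \<longlongrightarrow> l) (at_right s) \<Longrightarrow> right_lim y s = l"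
  unfolding right_lim_def by (rule tendsto_Lim) simp

section \<open>Partial derivatives of guards, resets and vector fields\<close>

text \<open>Partial derivatives are the total derivative restricted to the axes. The crossing rate
  thereby becomes the derivative of the guard along the flow, which is the number required to be
  nonzero in \<open>event_time_has_derivative\<close>.\<close>

lemma guard_partial_derivatives:
  fixes H :: "('q, 'n::finite, 'p::finite) hybrid_system"
  assumes G: "((\<lambda>(s, y). guard H k k' s y) has_derivative G') (at (t, x))"
  shows "Dt_guard H k k' t x = G' (1, 0)"
    and "(Dx_guard H k k' t x *v h) $ 1 = G' (0, h)"
    and "crossing_rate H k k' t x \<theta> = G' (1, vfield H k x \<theta>)"
proof -
  interpret G': bounded_linear G' using G by (rule has_derivative_bounded_linear)
  have "((\<lambda>s. (s, x)) has_derivative (\<lambda>h. (h, 0))) (at t)"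
    by (auto intro!: derivative_eq_intros)
  from diff_chain_at[OF this G]
  have "((\<lambda>s. guard H k k' s x) has_derivative (\<lambda>h. G' (h, 0))) (at t)"
    by (simp add: o_def)
  moreover have "(\<lambda>h. G' (h, 0)) = (*) (G' (1, 0))"
  proof
    show "G' (h, 0) = G' (1, 0) * h" for h
      using G'.scaleR[of h "(1, 0)"] by (simp add: mult.commute)
  qed
  ultimately have "((\<lambda>s. guard H k k' s x) has_field_derivative G' (1, 0)) (at t)"
    by (simp add: has_field_derivative_def)
  then show t: "Dt_guard H k k' t x = G' (1, 0)"
    unfolding Dt_guard_def by (rule DERIV_imp_deriv)
  have "((\<lambda>y. (t, y)) has_derivative (\<lambda>h. (0, h))) (at x)"
    by (auto intro!: derivative_eq_intros)
  from diff_chain_at[OF this G]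
  have "((\<lambda>y. guard H k k' t y) has_derivative (\<lambda>h. G' (0, h))) (at x)"
    by (simp add: o_def)
  moreover have "bounded_linear (vec :: real \<Rightarrow> real ^ 1)"
    by (simp add: linear_conv_bounded_linear[symmetric] linear_vec)
  ultimately have "((\<lambda>y. vec (guard H k k' t y) :: real ^ 1) has_derivative (\<lambda>h. vec (G' (0, h)))) (at x)"
    by (rule bounded_linear.has_derivative[rotated])
  then show x: "(Dx_guard H k k' t x *v h) $ 1 = G' (0, h)" for h
    unfolding Dx_guard_def by (simp add: jacobian_mult_vec)
  show "crossing_rate H k k' t x \<theta> = G' (1, vfield H k x \<theta>)"
    using G'.add[of "(1, 0)" "(0, vfield H k x \<theta>)"] by (simp add: crossing_rate_def t x)
qed

lemma reset_partial_derivatives: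
  fixes H :: "('q, 'n::finite, 'p::finite) hybrid_system"
  assumes R: "((\<lambda>(s, y, \<phi>). reset H k k' s y \<phi>) has_derivative R') (at (t, x, \<theta>))"
  shows "Dt_reset H k k' t x \<theta> = R' (1, 0, 0)"
    and "Dx_reset H k k' t x \<theta> *v y = R' (0, y, 0)"
    and "Dp_reset H k k' t x \<theta> *v h = R' (0, 0, h)"
proof -
  interpret R': bounded_linear R' using R by (rule has_derivative_bounded_linear)
  have "((\<lambda>s. (s, x, \<theta>)) has_derivative (\<lambda>h. (h, 0, 0))) (at t)"
    by (auto intro!: derivative_eq_intros simp: zero_prod_def)
  from diff_chain_at[OF this R]
  have "((\<lambda>s. reset H k k' s x \<theta>) has_derivative (\<lambda>h. R' (h, 0, 0))) (at t)"
    by (simp add: o_def)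
  moreover have "(\<lambda>h. R' (h, 0, 0)) = (\<lambda>h. h *\<^sub>R R' (1, 0, 0))"
  proof
    show "R' (h, 0, 0) = h *\<^sub>R R' (1, 0, 0)" for h
      using R'.scaleR[of h "(1, 0, 0)"] by simp
  qed
  ultimately show "Dt_reset H k k' t x \<theta> = R' (1, 0, 0)"
    unfolding Dt_reset_def by (intro vector_derivative_at) (simp add: has_vector_derivative_def)
  have "((\<lambda>y. (t, y, \<theta>)) has_derivative (\<lambda>h. (0, h, 0))) (at x)"
    by (auto intro!: derivative_eq_intros)
  from diff_chain_at[OF this R]
  have "((\<lambda>y. reset H k k' t y \<theta>) has_derivative (\<lambda>h. R' (0, h, 0))) (at x)"
    by (simp add: o_def)
  then show "Dx_reset H k k' t x \<theta> *v y = R' (0, y, 0)"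
    unfolding Dx_reset_def by (rule jacobian_mult_vec)
  have "((\<lambda>\<phi>. (t, x, \<phi>)) has_derivative (\<lambda>h. (0, 0, h))) (at \<theta>)"
    by (auto intro!: derivative_eq_intros)
  from diff_chain_at[OF this R]
  have "((\<lambda>\<phi>. reset H k k' t x \<phi>) has_derivative (\<lambda>h. R' (0, 0, h))) (at \<theta>)"
    by (simp add: o_def)
  then show "Dp_reset H k k' t x \<theta> *v h = R' (0, 0, h)"
    unfolding Dp_reset_def by (rule jacobian_mult_vec)
qed

lemma vfield_partial_derivatives:
  fixes H :: "('q, 'n::finite, 'p::finite) hybrid_system"
  assumes F: "((\<lambda>(y, \<phi>). vfield H k y \<phi>) has_derivative F') (at (x, \<theta>))"
  shows "Dx_vfield H k x \<theta> *v y = F' (y, 0)"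
    and "Dp_vfield H k x \<theta> *v h = F' (0, h)"
proof -
  have "((\<lambda>y. (y, \<theta>)) has_derivative (\<lambda>h. (h, 0))) (at x)"
    by (auto intro!: derivative_eq_intros)
  from diff_chain_at[OF this F]
  have "((\<lambda>y. vfield H k y \<theta>) has_derivative (\<lambda>h. F' (h, 0))) (at x)"
    by (simp add: o_def)
  then show "Dx_vfield H k x \<theta> *v y = F' (y, 0)"
    unfolding Dx_vfield_def by (rule jacobian_mult_vec)
  have "((\<lambda>\<phi>. (x, \<phi>)) has_derivative (\<lambda>h. (0, h))) (at \<theta>)"
    by (auto intro!: derivative_eq_intros)
  from diff_chain_at[OF this F]
  have "((\<lambda>\<phi>. vfield H k x \<phi>) has_derivative (\<lambda>h. F' (0, h))) (at \<theta>)"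
    by (simp add: o_def)
  then show "Dp_vfield H k x \<theta> *v h = F' (0, h)"
    unfolding Dp_vfield_def by (rule jacobian_mult_vec)
qed

section \<open>Arcs depending on a parameter\<close>

text \<open>The noise is taken at one fixed sample, so \<open>\<nu> j\<close> is a deterministic
  function of the parameter. The mode sequence \<open>q\<close> and the number \<open>N\<close> of
  transitions are shared by all nearby arcs.\<close>

locale hybrid_arc_family =
  fixes H :: "('q, 'n::finite, 'p::finite) hybrid_system"
    and \<nu> :: "nat \<Rightarrow> real ^ 'p \<Rightarrow> real ^ 'n"
    and x :: "real \<Rightarrow> real ^ 'p \<Rightarrow> real ^ 'n"
    and \<tau> :: "real ^ 'p \<Rightarrow> nat \<Rightarrow> real"
    and q :: "nat \<Rightarrow> 'q"
    and \<theta> :: "real ^ 'p" and t0 T :: real and N :: nat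
  assumes smooth: "smooth_hybrid_system H"
    and param: "\<theta> \<in> params H"
    and arc: "\<forall>\<^sub>F \<phi> in nhds \<theta>.
                hybrid_arc H (\<lambda>j. \<nu> j \<phi>) \<phi> t0 T N q (\<tau> \<phi>) (\<lambda>t. x t \<phi>)"
    and event_times: "\<And>j. j \<in> {1..N} \<Longrightarrow> isCont (\<lambda>\<phi>. \<tau> \<phi> j) \<theta>"
    and initial: "(\<lambda>\<phi>. x t0 \<phi>) differentiable (at \<theta>)"
    and noise: "\<And>j. j \<in> {1..N} \<Longrightarrow> (\<nu> j) differentiable (at \<theta>)"
    and transversal: "\<And>j. j \<in> {1..N} \<Longrightarrow>
          crossing_rate H (q (j - 1)) (q j) (\<tau> \<theta> j) (left_lim (\<lambda>t. x t \<theta>) (\<tau> \<theta> j)) \<theta> \<noteq> 0"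
begin

definition xm :: "nat \<Rightarrow> real ^ 'p \<Rightarrow> real ^ 'n" where
  "xm j \<phi> = left_lim (\<lambda>t. x t \<phi>) (\<tau> \<phi> j)"

text \<open>On an arc, index \<open>0\<close> gives the initial state, so the start can be handled
  like an event.\<close>

definition xp :: "nat \<Rightarrow> real ^ 'p \<Rightarrow> real ^ 'n" where
  "xp j \<phi> = right_lim (\<lambda>t. x t \<phi>) (\<tau> \<phi> j)"

abbreviation is_arc :: "real ^ 'p \<Rightarrow> bool" where
  "is_arc \<phi> \<equiv> hybrid_arc H (\<lambda>j. \<nu> j \<phi>) \<phi> t0 T N q (\<tau> \<phi>) (\<lambda>t. x t \<phi>)"

lemma arc_\<theta>: "is_arc \<theta>"
  using eventually_nhds_x_imp_x[OF arc] .

lemma arc_flow: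
  assumes "is_arc \<phi>" "j \<le> N"
  shows "q j \<in> modes H" "\<tau> \<phi> j < \<tau> \<phi> (Suc j)"
    and "\<And>t. \<tau> \<phi> j < t \<Longrightarrow> t < \<tau> \<phi> (Suc j) \<Longrightarrow> x t \<phi> \<in> states H"
    and "\<And>t. \<tau> \<phi> j < t \<Longrightarrow> t < \<tau> \<phi> (Suc j) \<Longrightarrow>
      ((\<lambda>t. x t \<phi>) has_vector_derivative vfield H (q j) (x t \<phi>) \<phi>) (at t)"
  using assms unfolding hybrid_arc_def by auto

lemma arc_event:
  assumes "is_arc \<phi>" "j \<in> {1..N}"
  shows "((\<lambda>t. x t \<phi>) \<longlongrightarrow> xm j \<phi>) (at_left (\<tau> \<phi> j))" "xm j \<phi> \<in> states H"
    and "((\<lambda>t. x t \<phi>) \<longlongrightarrow> xp j \<phi>) (at_right (\<tau> \<phi> j))" "xp j \<phi> \<in> states H"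
    and "guard H (q (j - 1)) (q j) (\<tau> \<phi> j) (xm j \<phi>) = 0"
    and "xp j \<phi> = reset H (q (j - 1)) (q j) (\<tau> \<phi> j) (xm j \<phi>) \<phi> + \<nu> j \<phi>"
proof -
  obtain ym yp where y: "ym \<in> states H" "yp \<in> states H"
    "((\<lambda>t. x t \<phi>) \<longlongrightarrow> ym) (at_left (\<tau> \<phi> j))" "((\<lambda>t. x t \<phi>) \<longlongrightarrow> yp) (at_right (\<tau> \<phi> j))"
    "guard H (q (j - 1)) (q j) (\<tau> \<phi> j) ym = 0"
    "yp = reset H (q (j - 1)) (q j) (\<tau> \<phi> j) ym \<phi> + \<nu> j \<phi>"
    using assms unfolding hybrid_arc_def by blast
  have "xm j \<phi> = ym" "xp j \<phi> = yp"
    using left_lim_eq[OF y(3)] right_lim_eq[OF y(4)] by (simp_all add: xm_def xp_def)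
  with y show "((\<lambda>t. x t \<phi>) \<longlongrightarrow> xm j \<phi>) (at_left (\<tau> \<phi> j))" "xm j \<phi> \<in> states H"
    "((\<lambda>t. x t \<phi>) \<longlongrightarrow> xp j \<phi>) (at_right (\<tau> \<phi> j))" "xp j \<phi> \<in> states H"
    "guard H (q (j - 1)) (q j) (\<tau> \<phi> j) (xm j \<phi>) = 0"
    "xp j \<phi> = reset H (q (j - 1)) (q j) (\<tau> \<phi> j) (xm j \<phi>) \<phi> + \<nu> j \<phi>"
    by simp_all
qed

lemma arc_initial:
  assumes "is_arc \<phi>"
  shows "\<tau> \<phi> 0 = t0" "xp 0 \<phi> = x t0 \<phi>" "((\<lambda>t. x t \<phi>) \<longlongrightarrow> x t0 \<phi>) (at_right t0)"
    "x t0 \<phi> \<in> states H"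
  using assms right_lim_eq[of "\<lambda>t. x t \<phi>" "x t0 \<phi>" t0]
  unfolding hybrid_arc_def xp_def by auto

lemma arc_start:
  assumes "is_arc \<phi>" "j \<le> N"
  shows "((\<lambda>t. x t \<phi>) \<longlongrightarrow> xp j \<phi>) (at_right (\<tau> \<phi> j))" "xp j \<phi> \<in> states H"
  using arc_event(3,4)[OF assms(1), of j] arc_initial[OF assms(1)] assms(2)
  by (cases "j = 0"; simp)+

text \<open>Indices \<open>0\<close> and \<open>Suc N\<close> mark the fixed ends \<open>t0\<close>
  and \<open>T\<close>, where the time is constant near \<theta>.\<close>

lemma isCont_time:
  assumes "j \<le> Suc N"
  shows "isCont (\<lambda>\<phi>. \<tau> \<phi> j) \<theta>"
proof -
  have const: "isCont (\<lambda>\<phi>. \<tau> \<phi> j) \<theta>" if "\<And>\<phi>. is_arc \<phi> \<Longrightarrow> \<tau> \<phi> j = c" for c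
  proof -
    have "\<forall>\<^sub>F \<phi> in nhds \<theta>. \<tau> \<phi> j = c" using arc by eventually_elim (rule that)
    from isCont_cong[OF this] show ?thesis by simp
  qed
  consider "j = 0" | "j \<in> {1..N}" | "j = Suc N" using assms by force
  then show ?thesis
  proof cases
    case 1
    then show ?thesis using const[of t0] arc_initial(1) by simp
  next
    case 2
    then show ?thesis by (rule event_times)
  next
    case 3
    then show ?thesis using const[of T] by (simp add: hybrid_arc_def)
  qed
qed

lemma vfield_C1:
  assumes "k \<in> modes H"
  obtains S F' where "open S" "\<And>y. y \<in> states H \<Longrightarrow> (y, \<theta>) \<in> S"
    "\<And>z. z \<in> S \<Longrightarrow> ((\<lambda>(y, \<phi>). vfield H k y \<phi>) has_derivative blinfun_apply (F' z)) (at z)"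
    "continuous_on S F'"
proof -
  obtain U where U: "open U" "states H \<subseteq> U"
      "C1_on (\<lambda>(x, \<theta>). vfield H k x \<theta>) (U \<times> params H)"
    using smooth assms unfolding smooth_hybrid_system_def by blast
  then obtain F' where F': "\<And>z. z \<in> U \<times> params H \<Longrightarrow>
      ((\<lambda>(y, \<phi>). vfield H k y \<phi>) has_derivative blinfun_apply (F' z)) (at z)"
    "continuous_on (U \<times> params H) F'"
    unfolding C1_on_def by blast
  have "open (U \<times> params H)"
    using U smooth by (simp add: open_Times smooth_hybrid_system_def)
  moreover have "(y, \<theta>) \<in> U \<times> params H" if "y \<in> states H" for y
    using that U(2) param by auto
  ultimately show thesis using F' that by blast
qed

section \<open>From one event to the next\<close>

text \<open>The induction invariant along the arc: the data from which the next segment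
  starts.\<close>

definition event_derivs :: "nat \<Rightarrow> (real ^ 'p \<Rightarrow> real) \<Rightarrow> (real ^ 'p \<Rightarrow> real ^ 'n) \<Rightarrow> bool" where
  "event_derivs j D\<tau> Dx \<longleftrightarrow>
     ((\<lambda>\<phi>. \<tau> \<phi> j) has_derivative D\<tau>) (at \<theta>) \<and> (xp j has_derivative Dx) (at \<theta>)"

text \<open>The two cases for \<open>b\<close> reflect that a limit from the left is available at
  the next event but not at \<open>T\<close>; the segment with \<open>j = N\<close> has to end
  strictly earlier.\<close>

lemma segment:
  assumes j: "j \<le> N" and D: "event_derivs j D\<tau> Dx"
    and b: "\<tau> \<theta> j < b" "b < \<tau> \<theta> (Suc j) \<or> b = \<tau> \<theta> (Suc j) \<and> j < N"
  obtains Z :: "real \<Rightarrow> (real ^ 'p) \<Rightarrow>\<^sub>L (real ^ 'n)" where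
    "continuous_on {\<tau> \<theta> j..b} Z"
    "\<And>h. Z (\<tau> \<theta> j) h = Dx h - D\<tau> h *\<^sub>R vfield H (q j) (xp j \<theta>) \<theta>"
    "\<And>t. \<tau> \<theta> j < t \<Longrightarrow> t < b \<Longrightarrow> (x t has_derivative Z t) (at \<theta>)"
    "\<And>t. \<tau> \<theta> j < t \<Longrightarrow> t < b \<Longrightarrow>
      ((\<lambda>t. matrix (blinfun_apply (Z t))) has_vector_derivative
        Dx_vfield H (q j) (x t \<theta>) \<theta> ** matrix (blinfun_apply (Z t)) + Dp_vfield H (q j) (x t \<theta>) \<theta>) (at t)"
    "\<And>\<epsilon>. b = \<tau> \<theta> (Suc j) \<Longrightarrow> 0 < \<epsilon> \<Longrightarrow> \<forall>\<^sub>F \<phi> in nhds \<theta>.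
      norm (xm (Suc j) \<phi> - xm (Suc j) \<theta> - Z b (\<phi> - \<theta>)
        - (\<tau> \<phi> (Suc j) - \<tau> \<theta> (Suc j)) *\<^sub>R vfield H (q j) (xm (Suc j) \<theta>) \<theta>)
      \<le> \<epsilon> * (norm (\<phi> - \<theta>) + \<bar>\<tau> \<phi> (Suc j) - \<tau> \<theta> (Suc j)\<bar>)"
proof -
  let ?F = "\<lambda>(y, \<phi>). vfield H (q j) y \<phi>"
  note flow = arc_flow[OF arc_\<theta> j]
  obtain S F' where S: "open S" and St: "\<And>y. y \<in> states H \<Longrightarrow> (y, \<theta>) \<in> S"
    and F: "\<And>z. z \<in> S \<Longrightarrow> (?F has_derivative blinfun_apply (F' z)) (at z)"
    and F': "continuous_on S F'"
    using vfield_C1[OF flow(1)] by blast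
  have b': "b \<le> \<tau> \<theta> (Suc j)" using b by auto
  define r where "r = (if b = \<tau> \<theta> (Suc j) then xm (Suc j) \<theta> else x b \<theta>)"
  have r: "((\<lambda>t. x t \<theta>) \<longlongrightarrow> r) (at_left b)" "r \<in> states H"
  proof -
    show "((\<lambda>t. x t \<theta>) \<longlongrightarrow> r) (at_left b)"
    proof (cases "b = \<tau> \<theta> (Suc j)")
      case True
      then show ?thesis using arc_event(1)[OF arc_\<theta>, of "Suc j"] b by (auto simp: r_def)
    next
      case False
      then have "isCont (\<lambda>t. x t \<theta>) b"
        using b flow(4)[of b] by (auto intro: has_vector_derivative_continuous)
      then show ?thesis
        using False by (auto simp: r_def isCont_def intro: filterlim_mono[OF _ order_refl at_le])
    qed
    show "r \<in> states H"
      using b flow(3)[of b] arc_event(2)[OF arc_\<theta>, of "Suc j"] by (auto simp: r_def)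
  qed
  obtain Z :: "real \<Rightarrow> (real ^ 'p) \<Rightarrow>\<^sub>L (real ^ 'n)" where Zc: "continuous_on {\<tau> \<theta> j..b} Z"
    and Z0: "\<And>h. Z (\<tau> \<theta> j) h = Dx h - D\<tau> h *\<^sub>R ?F (xp j \<theta>, \<theta>)"
    and Z': "\<And>t. \<tau> \<theta> j < t \<Longrightarrow> t < b \<Longrightarrow> \<exists>Zd. (Z has_vector_derivative Zd) (at t) \<and>
      (\<forall>h. Zd h = F' (x t \<theta>, \<theta>) (Z t h, h))"
    and exp: "\<And>\<beta> X \<epsilon>. \<tau> \<theta> j < \<beta> \<theta> \<Longrightarrow> \<beta> \<theta> \<le> b \<Longrightarrow> isCont \<beta> \<theta> \<Longrightarrow>
      \<forall>\<^sub>F \<phi> in nhds \<theta>. \<tau> \<phi> j < \<beta> \<phi> \<and>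
        (\<forall>t\<in>{\<tau> \<phi> j<..<\<beta> \<phi>}. ((\<lambda>t. x t \<phi>) has_vector_derivative ?F (x t \<phi>, \<phi>)) (at t)) \<and>
        ((\<lambda>t. x t \<phi>) \<longlongrightarrow> xp j \<phi>) (at_right (\<tau> \<phi> j)) \<and> ((\<lambda>t. x t \<phi>) \<longlongrightarrow> X \<phi>) (at_left (\<beta> \<phi>)) \<Longrightarrow>
      0 < \<epsilon> \<Longrightarrow>
      \<forall>\<^sub>F \<phi> in nhds \<theta>.
        norm (X \<phi> - X \<theta> - Z (\<beta> \<theta>) (\<phi> - \<theta>) - (\<beta> \<phi> - \<beta> \<theta>) *\<^sub>R ?F (X \<theta>, \<theta>))
          \<le> \<epsilon> * (norm (\<phi> - \<theta>) + \<bar>\<beta> \<phi> - \<beta> \<theta>\<bar>)"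
  proof (rule segment_sensitivity[OF S F F', of "\<lambda>\<phi>. \<tau> \<phi> j" \<theta> b "\<lambda>\<phi> t. x t \<phi>" "xp j" r D\<tau> Dx])
    show "((\<lambda>t. x t \<theta>) has_vector_derivative ?F (x t \<theta>, \<theta>)) (at t)" if "\<tau> \<theta> j < t" "t < b" for t
      using flow(4)[of t] that b' by simp
    show "(x t \<theta>, \<theta>) \<in> S" if "\<tau> \<theta> j < t" "t < b" for t
      using flow(3)[of t] that b' by (intro St) simp
  qed (use b(1) arc_start[OF arc_\<theta> j] St r D in \<open>auto simp: event_derivs_def\<close>)
  have \<tau>lim: "((\<lambda>\<phi>. \<tau> \<phi> i) \<longlongrightarrow> \<tau> \<theta> i) (nhds \<theta>)" if "i \<le> Suc N" for i
    using isCont_time[OF that] tendsto_at_iff_tendsto_nhds[of "\<lambda>\<phi>. \<tau> \<phi> i" \<theta>]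
    by (simp add: isCont_def)
  show thesis
  proof (rule that[OF Zc])
    show "Z (\<tau> \<theta> j) h = Dx h - D\<tau> h *\<^sub>R vfield H (q j) (xp j \<theta>) \<theta>" for h
      using Z0 by simp
  next
    fix t assume t: "\<tau> \<theta> j < t" "t < b"
    \<comment> \<open>Continuity of the event times keeps \<open>t\<close> inside the
      \<open>j\<close>-th segment of all nearby arcs. So \<open>exp\<close> applies with constant
      end time \<open>t\<close>, whose increment vanishes, and becomes plain
      differentiability.\<close>
    have "\<forall>\<^sub>F \<phi> in nhds \<theta>. \<tau> \<phi> j < t" "\<forall>\<^sub>F \<phi> in nhds \<theta>. t < \<tau> \<phi> (Suc j)"
      using order_tendstoD(2)[OF \<tau>lim[of j], of t] order_tendstoD(1)[OF \<tau>lim[of "Suc j"], of t] t b' j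
      by auto
    with arc have ev: "\<forall>\<^sub>F \<phi> in nhds \<theta>. \<tau> \<phi> j < t \<and>
        (\<forall>s\<in>{\<tau> \<phi> j<..<t}. ((\<lambda>t. x t \<phi>) has_vector_derivative ?F (x s \<phi>, \<phi>)) (at s)) \<and>
        ((\<lambda>t. x t \<phi>) \<longlongrightarrow> xp j \<phi>) (at_right (\<tau> \<phi> j)) \<and> ((\<lambda>t. x t \<phi>) \<longlongrightarrow> x t \<phi>) (at_left t)"
    proof eventually_elim
      case (elim \<phi>)
      have "isCont (\<lambda>t. x t \<phi>) t"
        using arc_flow(4)[OF elim(1) j elim(2,3)] by (rule has_vector_derivative_continuous)
      then have "((\<lambda>t. x t \<phi>) \<longlongrightarrow> x t \<phi>) (at_left t)"
        by (auto simp: isCont_def intro: filterlim_mono[OF _ order_refl at_le])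
      then show ?case
        using arc_flow(4)[OF elim(1) j] elim arc_start(1)[OF elim(1) j] by auto
    qed
    show "(x t has_derivative Z t) (at \<theta>)"
      unfolding has_derivative_at_nhds
      using exp[of "\<lambda>_. t" "x t", OF _ _ _ ev] t by (auto simp: blinfun.bounded_linear_right)
    obtain Zd where Zd: "(Z has_vector_derivative Zd) (at t)" "\<And>h. Zd h = F' (x t \<theta>, \<theta>) (Z t h, h)"
      using Z'[OF t] by blast
    have xS: "(x t \<theta>, \<theta>) \<in> S" using flow(3)[of t] t b' by (intro St) auto
    note vp = vfield_partial_derivatives[OF F[OF xS]]
    have "matrix (blinfun_apply Zd) *v h =
        (Dx_vfield H (q j) (x t \<theta>) \<theta> ** matrix (blinfun_apply (Z t)) + Dp_vfield H (q j) (x t \<theta>) \<theta>) *v h" for h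
      by (simp add: matrix_blinfun_mult_vec Zd(2) matrix_vector_mult_add_rdistrib vp
          matrix_vector_mul_assoc[symmetric] blinfun.add_right[symmetric])
    then have "matrix (blinfun_apply Zd) =
        Dx_vfield H (q j) (x t \<theta>) \<theta> ** matrix (blinfun_apply (Z t)) + Dp_vfield H (q j) (x t \<theta>) \<theta>"
      by (simp add: matrix_eq)
    with bounded_linear.has_vector_derivative[OF bounded_linear_matrix_blinfun Zd(1)]
    show "((\<lambda>t. matrix (blinfun_apply (Z t))) has_vector_derivative
        Dx_vfield H (q j) (x t \<theta>) \<theta> ** matrix (blinfun_apply (Z t)) + Dp_vfield H (q j) (x t \<theta>) \<theta>) (at t)"
      by simp
  next
    fix \<epsilon> :: real assume be: "b = \<tau> \<theta> (Suc j)" and \<epsilon>: "0 < \<epsilon>"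
    then have jN: "Suc j \<in> {1..N}" using b by auto
    have ev: "\<forall>\<^sub>F \<phi> in nhds \<theta>. \<tau> \<phi> j < \<tau> \<phi> (Suc j) \<and>
        (\<forall>s\<in>{\<tau> \<phi> j<..<\<tau> \<phi> (Suc j)}. ((\<lambda>t. x t \<phi>) has_vector_derivative ?F (x s \<phi>, \<phi>)) (at s)) \<and>
        ((\<lambda>t. x t \<phi>) \<longlongrightarrow> xp j \<phi>) (at_right (\<tau> \<phi> j)) \<and>
        ((\<lambda>t. x t \<phi>) \<longlongrightarrow> xm (Suc j) \<phi>) (at_left (\<tau> \<phi> (Suc j)))"
      using arc
    proof eventually_elim
      case (elim \<phi>)
      then show ?case
        using arc_flow[OF elim j] arc_start(1)[OF elim j] arc_event(1)[OF elim jN] by auto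
    qed
    show "\<forall>\<^sub>F \<phi> in nhds \<theta>.
      norm (xm (Suc j) \<phi> - xm (Suc j) \<theta> - Z b (\<phi> - \<theta>)
        - (\<tau> \<phi> (Suc j) - \<tau> \<theta> (Suc j)) *\<^sub>R vfield H (q j) (xm (Suc j) \<theta>) \<theta>)
      \<le> \<epsilon> * (norm (\<phi> - \<theta>) + \<bar>\<tau> \<phi> (Suc j) - \<tau> \<theta> (Suc j)\<bar>)"
      using exp[of "\<lambda>\<phi>. \<tau> \<phi> (Suc j)" "xm (Suc j)", OF _ _ _ ev \<epsilon>] isCont_time[of "Suc j"] be b(1) j
      by simp
  qed
qed

definition \<Xi> :: "nat \<Rightarrow> real ^ 'n ^ 'n" where
  "\<Xi> j = saltation_matrix H (q (j - 1)) (q j) (\<tau> \<theta> j) (xm j \<theta>) (xp j \<theta>) \<theta>"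

definition DR :: "nat \<Rightarrow> real ^ 'p ^ 'n" where
  "DR j = Dp_reset H (q (j - 1)) (q j) (\<tau> \<theta> j) (xm j \<theta>) \<theta>"

text \<open>The left-hand side of the second conclusion is the initial value of \<open>Z\<close> on
  the next segment as produced by \<open>segment\<close>; the lemma identifies it with the asserted
  sensitivity update.\<close>

lemma event_step:
  fixes Z :: "(real ^ 'p) \<Rightarrow>\<^sub>L (real ^ 'n)"
  assumes j: "j < N"
    and exp: "\<And>\<epsilon>. 0 < \<epsilon> \<Longrightarrow> \<forall>\<^sub>F \<phi> in nhds \<theta>.
      norm (xm (Suc j) \<phi> - xm (Suc j) \<theta> - Z (\<phi> - \<theta>)
        - (\<tau> \<phi> (Suc j) - \<tau> \<theta> (Suc j)) *\<^sub>R vfield H (q j) (xm (Suc j) \<theta>) \<theta>)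
      \<le> \<epsilon> * (norm (\<phi> - \<theta>) + \<bar>\<tau> \<phi> (Suc j) - \<tau> \<theta> (Suc j)\<bar>)"
  obtains D\<tau> Dx where "event_derivs (Suc j) D\<tau> Dx"
    and "\<And>h. Dx h - D\<tau> h *\<^sub>R vfield H (q (Suc j)) (xp (Suc j) \<theta>) \<theta> =
      (\<Xi> (Suc j) ** matrix (blinfun_apply Z) + DR (Suc j) + jacobian (\<nu> (Suc j)) (at \<theta>)) *v h"
proof -
  have jN: "Suc j \<in> {1..N}" using j by auto
  let ?k = "q j" and ?k' = "q (Suc j)" and ?t = "\<tau> \<theta> (Suc j)" and ?y = "xm (Suc j) \<theta>"
  have modes: "?k \<in> modes H" "?k' \<in> modes H" using arc_flow(1)[OF arc_\<theta>] j by auto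
  have y: "?y \<in> states H" by (rule arc_event(2)[OF arc_\<theta> jN])
  have "(\<lambda>(s, y). guard H ?k ?k' s y) differentiable (at (?t, ?y))"
    "(\<lambda>(s, y, \<phi>). reset H ?k ?k' s y \<phi>) differentiable (at (?t, ?y, \<theta>))"
    using smooth modes y param unfolding smooth_hybrid_system_def by blast+
  then obtain G' R' where G: "((\<lambda>(s, y). guard H ?k ?k' s y) has_derivative G') (at (?t, ?y))"
    and R: "((\<lambda>(s, y, \<phi>). reset H ?k ?k' s y \<phi>) has_derivative R') (at (?t, ?y, \<theta>))"
    unfolding differentiable_def by blast
  interpret R': bounded_linear R' using R by (rule has_derivative_bounded_linear)
  note gp = guard_partial_derivatives[OF G] and rp = reset_partial_derivatives[OF R]
  define f where "f = vfield H ?k ?y \<theta>"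
  define fp where "fp = vfield H ?k' (xp (Suc j) \<theta>) \<theta>"
  define c where "c = crossing_rate H ?k ?k' ?t ?y \<theta>"
  have cG: "c = G' (1, f)" by (simp add: c_def f_def gp)
  have c0: "c \<noteq> 0" using transversal[OF jN] by (simp add: c_def xm_def)
  define L where "L = (\<lambda>h. - G' (0, Z h) / c)"
  have zero: "\<forall>\<^sub>F \<phi> in nhds \<theta>. (case (\<tau> \<phi> (Suc j), xm (Suc j) \<phi>) of (s, y) \<Rightarrow> guard H ?k ?k' s y) = 0"
    using arc by eventually_elim (use arc_event(5)[OF _ jN] in simp)
  have "isCont (\<lambda>\<phi>. \<tau> \<phi> (Suc j)) \<theta>" by (rule event_times[OF jN])
  note ev = event_time_has_derivative[where \<tau> = "\<lambda>\<phi>. \<tau> \<phi> (Suc j)" and X = "xm (Suc j)" and Z = Z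
      and f = f and G = "\<lambda>(s, y). guard H ?k ?k' s y", OF this exp[folded f_def] blinfun.bounded_linear_right G zero]
  have D\<tau>: "((\<lambda>\<phi>. \<tau> \<phi> (Suc j)) has_derivative L) (at \<theta>)"
    and Dxm: "(xm (Suc j) has_derivative (\<lambda>h. Z h + L h *\<^sub>R f)) (at \<theta>)"
    using ev c0 unfolding L_def cG f_def by auto
  obtain D\<nu> where D\<nu>: "(\<nu> (Suc j) has_derivative D\<nu>) (at \<theta>)"
    using noise[OF jN] unfolding differentiable_def by blast
  have "((\<lambda>\<phi>. (\<tau> \<phi> (Suc j), xm (Suc j) \<phi>, \<phi>)) has_derivative (\<lambda>h. (L h, Z h + L h *\<^sub>R f, h))) (at \<theta>)"
    by (intro has_derivative_Pair D\<tau> Dxm has_derivative_ident)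
  from has_derivative_add[OF diff_chain_at[OF this R] D\<nu>]
  have D: "((\<lambda>\<phi>. reset H ?k ?k' (\<tau> \<phi> (Suc j)) (xm (Suc j) \<phi>) \<phi> + \<nu> (Suc j) \<phi>) has_derivative
      (\<lambda>h. R' (L h, Z h + L h *\<^sub>R f, h) + D\<nu> h)) (at \<theta>)"
    by (simp add: o_def)
  have eq: "\<forall>\<^sub>F \<phi> in nhds \<theta>. reset H ?k ?k' (\<tau> \<phi> (Suc j)) (xm (Suc j) \<phi>) \<phi> + \<nu> (Suc j) \<phi> = xp (Suc j) \<phi>"
    using arc by eventually_elim (use arc_event(6)[OF _ jN] in simp)
  have Dxp: "(xp (Suc j) has_derivative (\<lambda>h. R' (L h, Z h + L h *\<^sub>R f, h) + D\<nu> h)) (at \<theta>)"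
    by (rule has_derivative_transform_eventually[OF D])
      (use eq eventually_nhds_x_imp_x[OF eq] in \<open>auto simp: eventually_at_filter elim: eventually_mono\<close>)
  show thesis
  proof (rule that)
    show "event_derivs (Suc j) L (\<lambda>h. R' (L h, Z h + L h *\<^sub>R f, h) + D\<nu> h)"
      using D\<tau> Dxp by (simp add: event_derivs_def)
    fix h
    \<comment> \<open>Three terms carry the event time derivative \<open>L h\<close>: the time
      derivative of the reset, the reset image of the old velocity, and the subtracted new velocity.
      With \<open>L h = - G' (0, Z h) / c\<close> they form the rank-one part of
      \<open>\<Xi>\<close>.\<close>
    have "(L h, Z h + L h *\<^sub>R f, h) =
        L h *\<^sub>R (1, 0, 0) + (0, Z h, 0) + L h *\<^sub>R (0, f, 0) + (0, 0, h)" by simp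
    then have R'L: "R' (L h, Z h + L h *\<^sub>R f, h) =
        L h *\<^sub>R R' (1, 0, 0) + R' (0, Z h, 0) + L h *\<^sub>R R' (0, f, 0) + R' (0, 0, h)"
      by (simp only: R'.add R'.scaleR)
    have "\<Xi> (Suc j) *v Z h = R' (0, Z h, 0) + (G' (0, Z h) / c) *\<^sub>R (fp - R' (0, f, 0) - R' (1, 0, 0))"
      by (simp add: \<Xi>_def saltation_matrix_def matrix_vector_mult_add_rdistrib
          scaleR_matrix_vector_assoc[symmetric] columnvector_mult_row rp gp(2)
          c_def[symmetric] f_def[symmetric] fp_def[symmetric])
    moreover have "(\<Xi> (Suc j) ** matrix (blinfun_apply Z) + DR (Suc j) + jacobian (\<nu> (Suc j)) (at \<theta>)) *v h
       = \<Xi> (Suc j) *v Z h + R' (0, 0, h) + D\<nu> h"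
      by (simp add: matrix_vector_mult_add_rdistrib matrix_vector_mul_assoc[symmetric]
          matrix_blinfun_mult_vec DR_def rp jacobian_mult_vec[OF D\<nu>])
    ultimately show "R' (L h, Z h + L h *\<^sub>R f, h) + D\<nu> h - L h *\<^sub>R vfield H (q (Suc j)) (xp (Suc j) \<theta>) \<theta> =
      (\<Xi> (Suc j) ** matrix (blinfun_apply Z) + DR (Suc j) + jacobian (\<nu> (Suc j)) (at \<theta>)) *v h"
      unfolding R'L fp_def[symmetric] by (simp add: L_def algebra_simps)
  qed
qed

lemma event_derivs_exist:
  assumes "j \<le> N"
  shows "\<exists>D\<tau> Dx. event_derivs j D\<tau> Dx"
  using assms
proof (induction j)
  case 0
  obtain D where D: "(x t0 has_derivative D) (at \<theta>)"
    using initial unfolding differentiable_def by blast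
  have eq: "\<forall>\<^sub>F \<phi> in nhds \<theta>. x t0 \<phi> = xp 0 \<phi>" "\<forall>\<^sub>F \<phi> in nhds \<theta>. t0 = \<tau> \<phi> 0"
    using arc by (eventually_elim, simp add: arc_initial)+
  have "(xp 0 has_derivative D) (at \<theta>)"
    by (rule has_derivative_transform_eventually[OF D])
      (use eq(1) eventually_nhds_x_imp_x[OF eq(1)] in \<open>auto simp: eventually_at_filter elim: eventually_mono\<close>)
  moreover have "((\<lambda>\<phi>. \<tau> \<phi> 0) has_derivative (\<lambda>_. 0)) (at \<theta>)"
    by (rule has_derivative_transform_eventually[OF has_derivative_const[of t0]])
      (use eq(2) eventually_nhds_x_imp_x[OF eq(2)] in \<open>auto simp: eventually_at_filter elim: eventually_mono\<close>)
  ultimately show ?case unfolding event_derivs_def by blast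
next
  case (Suc j)
  then obtain D\<tau> Dx where D: "event_derivs j D\<tau> Dx" by auto
  have jN: "j \<le> N" "j < N" using Suc.prems by auto
  obtain Z :: "real \<Rightarrow> (real ^ 'p) \<Rightarrow>\<^sub>L (real ^ 'n)" where
    "continuous_on {\<tau> \<theta> j..\<tau> \<theta> (Suc j)} Z" and
    exp: "\<And>\<epsilon>. 0 < \<epsilon> \<Longrightarrow> \<forall>\<^sub>F \<phi> in nhds \<theta>.
      norm (xm (Suc j) \<phi> - xm (Suc j) \<theta> - Z (\<tau> \<theta> (Suc j)) (\<phi> - \<theta>)
        - (\<tau> \<phi> (Suc j) - \<tau> \<theta> (Suc j)) *\<^sub>R vfield H (q j) (xm (Suc j) \<theta>) \<theta>)
      \<le> \<epsilon> * (norm (\<phi> - \<theta>) + \<bar>\<tau> \<phi> (Suc j) - \<tau> \<theta> (Suc j)\<bar>)"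
  proof (rule segment[OF jN(1) D arc_flow(2)[OF arc_\<theta> jN(1)]])
    show "\<tau> \<theta> (Suc j) < \<tau> \<theta> (Suc j) \<or> \<tau> \<theta> (Suc j) = \<tau> \<theta> (Suc j) \<and> j < N"
      using jN by simp
  qed (erule that; simp)
  show ?case by (rule event_step[OF jN(2) exp]) auto
qed

section \<open>Sensitivities between and at events\<close>

lemma sensitivity_flow:
  assumes j: "j \<le> N" and t: "\<tau> \<theta> j < t" "t < \<tau> \<theta> (Suc j)"
  shows "x t differentiable (at \<theta>)"
    and "(sensitivity x \<theta> has_vector_derivative
      Dx_vfield H (q j) (x t \<theta>) \<theta> ** sensitivity x \<theta> t + Dp_vfield H (q j) (x t \<theta>) \<theta>) (at t)"
proof -
  obtain D\<tau> Dx where D: "event_derivs j D\<tau> Dx" using event_derivs_exist[OF j] by blast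
  \<comment> \<open>Stopping strictly before the end of the segment treats the last one like the
    others.\<close>
  obtain b where b: "t < b" "b < \<tau> \<theta> (Suc j)" using dense[OF t(2)] by blast
  obtain Z :: "real \<Rightarrow> (real ^ 'p) \<Rightarrow>\<^sub>L (real ^ 'n)" where
    Z: "\<And>t. \<tau> \<theta> j < t \<Longrightarrow> t < b \<Longrightarrow> (x t has_derivative Z t) (at \<theta>)"
    and Z': "\<And>t. \<tau> \<theta> j < t \<Longrightarrow> t < b \<Longrightarrow>
      ((\<lambda>t. matrix (blinfun_apply (Z t))) has_vector_derivative
        Dx_vfield H (q j) (x t \<theta>) \<theta> ** matrix (blinfun_apply (Z t)) + Dp_vfield H (q j) (x t \<theta>) \<theta>) (at t)"
  proof (rule segment[OF j D, of b])
    show "\<tau> \<theta> j < b" "b < \<tau> \<theta> (Suc j) \<or> b = \<tau> \<theta> (Suc j) \<and> j < N" using b t by auto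
  qed (rule that; assumption)
  show "x t differentiable (at \<theta>)" using Z[OF t(1) b(1)] by (rule differentiableI)
  have sZ: "sensitivity x \<theta> s = matrix (blinfun_apply (Z s))" if "\<tau> \<theta> j < s" "s < b" for s
    unfolding sensitivity_def by (rule jacobian_eq_matrix[OF Z[OF that]])
  show "(sensitivity x \<theta> has_vector_derivative
      Dx_vfield H (q j) (x t \<theta>) \<theta> ** sensitivity x \<theta> t + Dp_vfield H (q j) (x t \<theta>) \<theta>) (at t)"
    unfolding sZ[OF t(1) b(1)]
    by (rule has_vector_derivative_transform_within_open[OF Z'[OF t(1) b(1)], of "{\<tau> \<theta> j<..<b}"])
      (use t b in \<open>auto simp: sZ\<close>)
qed

text \<open>The sensitivity is identified with \<open>Z\<close> and \<open>Y\<close> only off the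
  event. Its one-sided limits there are the end values of these solutions, by their continuity on
  closed intervals, and \<open>event_step\<close> relates the two values.\<close>

lemma sensitivity_jump:
  assumes j: "j < N"
  obtains Zm where "(sensitivity x \<theta> \<longlongrightarrow> Zm) (at_left (\<tau> \<theta> (Suc j)))"
    and "(sensitivity x \<theta> \<longlongrightarrow> \<Xi> (Suc j) ** Zm + DR (Suc j) + jacobian (\<nu> (Suc j)) (at \<theta>))
      (at_right (\<tau> \<theta> (Suc j)))"
proof -
  let ?s = "\<tau> \<theta> (Suc j)"
  have jN: "j \<le> N" "Suc j \<le> N" using j by auto
  note lt = arc_flow(2)[OF arc_\<theta> jN(1)] arc_flow(2)[OF arc_\<theta> jN(2)]
  obtain D\<tau> Dx where D: "event_derivs j D\<tau> Dx" using event_derivs_exist[OF jN(1)] by blast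
  obtain Z :: "real \<Rightarrow> (real ^ 'p) \<Rightarrow>\<^sub>L (real ^ 'n)" where
    Zc: "continuous_on {\<tau> \<theta> j..?s} Z"
    and Z: "\<And>t. \<tau> \<theta> j < t \<Longrightarrow> t < ?s \<Longrightarrow> (x t has_derivative Z t) (at \<theta>)"
    and exp: "\<And>\<epsilon>. 0 < \<epsilon> \<Longrightarrow> \<forall>\<^sub>F \<phi> in nhds \<theta>.
      norm (xm (Suc j) \<phi> - xm (Suc j) \<theta> - Z ?s (\<phi> - \<theta>)
        - (\<tau> \<phi> (Suc j) - \<tau> \<theta> (Suc j)) *\<^sub>R vfield H (q j) (xm (Suc j) \<theta>) \<theta>)
      \<le> \<epsilon> * (norm (\<phi> - \<theta>) + \<bar>\<tau> \<phi> (Suc j) - \<tau> \<theta> (Suc j)\<bar>)"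
  proof (rule segment[OF jN(1) D lt(1)])
    show "?s < ?s \<or> ?s = ?s \<and> j < N" using j by simp
  qed (erule that; simp)
  obtain E\<tau> Ex where E: "event_derivs (Suc j) E\<tau> Ex"
    and Ejump: "\<And>h. Ex h - E\<tau> h *\<^sub>R vfield H (q (Suc j)) (xp (Suc j) \<theta>) \<theta> =
      (\<Xi> (Suc j) ** matrix (blinfun_apply (Z ?s)) + DR (Suc j) + jacobian (\<nu> (Suc j)) (at \<theta>)) *v h"
    by (rule event_step[OF j exp], assumption, rule that)
  obtain b where b: "?s < b" "b < \<tau> \<theta> (Suc (Suc j))" using dense[OF lt(2)] by blast
  obtain Y :: "real \<Rightarrow> (real ^ 'p) \<Rightarrow>\<^sub>L (real ^ 'n)" where
    Yc: "continuous_on {?s..b} Y"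
    and Y0: "\<And>h. Y ?s h = Ex h - E\<tau> h *\<^sub>R vfield H (q (Suc j)) (xp (Suc j) \<theta>) \<theta>"
    and Y: "\<And>t. ?s < t \<Longrightarrow> t < b \<Longrightarrow> (x t has_derivative Y t) (at \<theta>)"
  proof (rule segment[OF jN(2) E b(1)])
    show "b < \<tau> \<theta> (Suc (Suc j)) \<or> b = \<tau> \<theta> (Suc (Suc j)) \<and> Suc j < N" using b by simp
  qed (erule that; assumption)
  note mat = bounded_linear.tendsto[OF bounded_linear_matrix_blinfun]
  have "\<forall>\<^sub>F t in at_left ?s. matrix (blinfun_apply (Z t)) = sensitivity x \<theta> t"
    using eventually_at_left_real[OF lt(1)]
    by eventually_elim (simp add: sensitivity_def jacobian_eq_matrix[OF Z])
  moreover have "(Z \<longlongrightarrow> Z ?s) (at_left ?s)"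
    using continuous_on_Icc_at_leftD[OF Zc lt(1)] .
  ultimately have left: "(sensitivity x \<theta> \<longlongrightarrow> matrix (blinfun_apply (Z ?s))) (at_left ?s)"
    by (intro Lim_transform_eventually[OF mat])
  have "\<forall>\<^sub>F t in at_right ?s. matrix (blinfun_apply (Y t)) = sensitivity x \<theta> t"
    using eventually_at_right_real[OF b(1)]
    by eventually_elim (simp add: sensitivity_def jacobian_eq_matrix[OF Y])
  moreover have "(Y \<longlongrightarrow> Y ?s) (at_right ?s)"
    using continuous_on_Icc_at_rightD[OF Yc b(1)] .
  ultimately have right: "(sensitivity x \<theta> \<longlongrightarrow> matrix (blinfun_apply (Y ?s))) (at_right ?s)"
    by (intro Lim_transform_eventually[OF mat])
  have "matrix (blinfun_apply (Y ?s)) =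
      \<Xi> (Suc j) ** matrix (blinfun_apply (Z ?s)) + DR (Suc j) + jacobian (\<nu> (Suc j)) (at \<theta>)"
    by (simp add: matrix_eq matrix_blinfun_mult_vec Y0 Ejump)
  with left right show thesis by (intro that) simp_all
qed

end

theorem mainTheorem2:
  fixes H :: "('q, 'n::finite, 'p::finite) hybrid_system"
    and M :: "'w measure" and \<omega> :: 'w
    and \<eta> :: "nat \<Rightarrow> real ^ 'p \<Rightarrow> 'w \<Rightarrow> real ^ 'n"
    and x :: "real \<Rightarrow> real ^ 'p \<Rightarrow> real ^ 'n"
    and \<tau> :: "real ^ 'p \<Rightarrow> nat \<Rightarrow> real"
    and q :: "nat \<Rightarrow> 'q"
    and \<theta> :: "real ^ 'p" and t0 T :: real and N :: nat
  assumes smooth: "smooth_hybrid_system H"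
    and param: "\<theta> \<in> params H"
    and prob: "prob_space M" and sample: "\<omega> \<in> space M"
    and arc: "\<forall>\<^sub>F \<phi> in nhds \<theta>.
                hybrid_arc H (\<lambda>j. \<eta> j \<phi> \<omega>) \<phi> t0 T N q (\<tau> \<phi>) (\<lambda>t. x t \<phi>)"
    and event_times: "\<forall>j\<in>{1..N}. isCont (\<lambda>\<phi>. \<tau> \<phi> j) \<theta>"
    and initial: "(\<lambda>\<phi>. x t0 \<phi>) differentiable (at \<theta>)"
    and noise: "\<forall>j\<in>{1..N}. (\<lambda>\<phi>. \<eta> j \<phi> \<omega>) differentiable (at \<theta>)"
    and transversal: "\<forall>j\<in>{1..N}.
          crossing_rate H (q (j - 1)) (q j) (\<tau> \<theta> j) (left_lim (\<lambda>t. x t \<theta>) (\<tau> \<theta> j)) \<theta> \<noteq> 0"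
  shows
    "let Z = sensitivity x \<theta>;
         xm = (\<lambda>j. left_lim (\<lambda>t. x t \<theta>) (\<tau> \<theta> j));
         xp = (\<lambda>j. right_lim (\<lambda>t. x t \<theta>) (\<tau> \<theta> j));
         \<Xi> = (\<lambda>j. saltation_matrix H (q (j - 1)) (q j) (\<tau> \<theta> j) (xm j) (xp j) \<theta>);
         DR = (\<lambda>j. Dp_reset H (q (j - 1)) (q j) (\<tau> \<theta> j) (xm j) \<theta>);
         D\<eta> = (\<lambda>j. jacobian (\<lambda>\<phi>. \<eta> j \<phi> \<omega>) (at \<theta>))
     in
       (\<forall>j\<le>N. \<forall>t\<in>{\<tau> \<theta> j<..<\<tau> \<theta> (Suc j)}.
          (\<lambda>\<phi>. x t \<phi>) differentiable (at \<theta>) \<and>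
          (Z has_vector_derivative
             Dx_vfield H (q j) (x t \<theta>) \<theta> ** Z t + Dp_vfield H (q j) (x t \<theta>) \<theta>) (at t)) \<and>
       (\<forall>j\<in>{1..N}.
          (Z \<longlongrightarrow> left_lim Z (\<tau> \<theta> j)) (at_left (\<tau> \<theta> j)) \<and>
          (Z \<longlongrightarrow> right_lim Z (\<tau> \<theta> j)) (at_right (\<tau> \<theta> j)) \<and>
          right_lim Z (\<tau> \<theta> j) = \<Xi> j ** left_lim Z (\<tau> \<theta> j) + DR j + D\<eta> j) \<and>
       (iid_sequence M (\<lambda>j. \<eta> j \<theta>) \<and> (\<forall>j\<in>{1..N}. D\<eta> j = 0) \<longrightarrow>
          (\<forall>j\<in>{1..N}. right_lim Z (\<tau> \<theta> j) = \<Xi> j ** left_lim Z (\<tau> \<theta> j) + DR j))"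
proof -
  interpret hybrid_arc_family H "\<lambda>j \<phi>. \<eta> j \<phi> \<omega>" x \<tau> q \<theta> t0 T N
    using smooth param arc event_times initial noise transversal by unfold_locales auto
  let ?Z = "sensitivity x \<theta>"
  have jump: "(?Z \<longlongrightarrow> left_lim ?Z (\<tau> \<theta> j)) (at_left (\<tau> \<theta> j)) \<and>
      (?Z \<longlongrightarrow> right_lim ?Z (\<tau> \<theta> j)) (at_right (\<tau> \<theta> j)) \<and>
      right_lim ?Z (\<tau> \<theta> j) = \<Xi> j ** left_lim ?Z (\<tau> \<theta> j) + DR j + jacobian (\<lambda>\<phi>. \<eta> j \<phi> \<omega>) (at \<theta>)"
    if "j \<in> {1..N}" for j
  proof -
    \<comment> \<open>Events are numbered from \<open>1\<close>, while the jump is stated for the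
      event ending segment \<open>i\<close>.\<close>
    define i where "i = j - 1"
    have i: "j = Suc i" "i < N" using that by (auto simp: i_def)
    obtain Zm where Zm: "(?Z \<longlongrightarrow> Zm) (at_left (\<tau> \<theta> j))"
      "(?Z \<longlongrightarrow> \<Xi> j ** Zm + DR j + jacobian (\<lambda>\<phi>. \<eta> j \<phi> \<omega>) (at \<theta>)) (at_right (\<tau> \<theta> j))"
      using sensitivity_jump[OF i(2)] unfolding i(1) .
    show ?thesis
      using Zm by (simp add: left_lim_eq[OF Zm(1)] right_lim_eq[OF Zm(2)])
  qed
  have flow: "(\<lambda>\<phi>. x t \<phi>) differentiable (at \<theta>) \<and> (?Z has_vector_derivative
      Dx_vfield H (q j) (x t \<theta>) \<theta> ** ?Z t + Dp_vfield H (q j) (x t \<theta>) \<theta>) (at t)"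
    if "j \<le> N" "t \<in> {\<tau> \<theta> j<..<\<tau> \<theta> (Suc j)}" for j t
    using sensitivity_flow[OF that(1), of t] that(2) by simp
  show ?thesis
    unfolding Let_def \<Xi>_def[unfolded xm_def xp_def, symmetric] DR_def[unfolded xm_def, symmetric]
    using flow jump by (intro conjI ballI allI impI; (blast | simp))
qed

end
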